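(* Let $X\subset\mathbb P^3$ be a smooth irreducible curve of degree $d\ge2$ over $\mathbb C$, and let $m$ be the common degree of its dual image curves for generic camera centers. Given views of $X$ with known camera matrices, the reconstruction of $X$ in the dual space can be done linearly using at least $$k\ \ge\ \frac{m^2+6m+11}{3(m+3)}$$ views.
   Context: A camera is a central projection $\mathbb P^3\setminus\{\mathbf O\}\to\mathbb P^2$ with center $\mathbf O$, given by a $3\times4$ matrix $\mathbf M$ with $\mathbf M\mathbf O=0$; a view of $X$ is its image under such a projection. For a line $\mathbf l\in\mathbb P^{2\star}$ of the image plane, $\mu(\mathbf l)=\mathbf M^T\mathbf l\in\mathbb P^{3\star}$ is the plane spanned by $\mathbf l$ and the camera center. The dual variety $X^\star\subset\mathbb P^{3\star}$ of $X$ is a hypersurface (since $X$ is not a line), and $\Upsilon$ is a minimal-degree polynomial defining it. Reconstruction in the dual space means recovering $X^\star$, i.e. $\Upsilon$, from the views. For a generic camera center, the image curve $Y$ (projection of $X$) has a dual curve $Y^\star$ of degree $m$ independent of the center (namely $m=2d+2g-2$ with $g$ the genus of $X$), and $\phi$ denotes the irreducible degree-$m$ polynomial defining $Y^\star$; $\Upsilon$ also has degree $m$, hence has $\binom{m+3}{m}$ coefficients. Reconstruction is done linearly by means of the following equations. For each view there is a scalar $\lambda$ with $\Upsilon(\mu(\mathbf l))=\lambda\,\phi(\mathbf l)$ for all lines $\mathbf l\in\mathbb P^{2\star}$. Eliminating $\lambda$ gives $\binom{m+2}{m}-1$ linear equations per view on the coefficients of $\Upsilon$. *)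

theory Defs
  imports "HOL-Analysis.Analysis" "HOL-Library.Poly_Mapping" "HOL-Computational_Algebra.Factorial_Ring"
begin

section \<open>Forms\<close>

text \<open>
  Complex polynomials in variables indexed by \<open>'v\<close>: finitely supported coefficient functions on
  exponent vectors, with convolution as product.
\<close>

type_synonym 'v cpoly = "('v \<Rightarrow>\<^sub>0 nat) \<Rightarrow>\<^sub>0 complex"

definition peval :: "'v cpoly \<Rightarrow> ('v \<Rightarrow> complex) \<Rightarrow> complex" where
  "peval p x = (\<Sum>e\<in>Poly_Mapping.keys p.
     Poly_Mapping.lookup p e * (\<Prod>i\<in>Poly_Mapping.keys e. x i ^ Poly_Mapping.lookup e i))"

definition exponents :: "nat \<Rightarrow> ('v \<Rightarrow>\<^sub>0 nat) set" where
  "exponents n = {e. (\<Sum>i\<in>Poly_Mapping.keys e. Poly_Mapping.lookup e i) = n}"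

text \<open>The zero polynomial is a form of every degree.\<close>

definition form :: "nat \<Rightarrow> 'v cpoly \<Rightarrow> bool" where
  "form n p \<longleftrightarrow> Poly_Mapping.keys p \<subseteq> exponents n"

section \<open>Projective varieties\<close>

text \<open>
  A subset of complex projective space is represented by the set of all homogeneous coordinate
  vectors of its points, a set of nonzero vectors. Hyperplanes have coordinate vectors in the same
  space; \<open>pairing h x = 0\<close> says that the point \<open>x\<close> lies on the hyperplane \<open>h\<close>.
\<close>

definition pairing :: "complex^'n \<Rightarrow> complex^'n \<Rightarrow> complex" where
  "pairing h x = (\<Sum>i\<in>UNIV. h $ i * x $ i)"

definition proj_point :: "complex^'n \<Rightarrow> (complex^'n) set" where
  "proj_point x = range (\<lambda>c. c *s x)"

definition zero_locus :: "('n::finite) cpoly set \<Rightarrow> (complex^'n) set" where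
  "zero_locus S = {x. x \<noteq> 0 \<and> (\<forall>p\<in>S. peval p (($) x) = 0)}"

definition vanishing_forms :: "(complex^'n) set \<Rightarrow> ('n::finite) cpoly set" where
  "vanishing_forms V = {p. (\<exists>n. form n p) \<and> (\<forall>x\<in>V. peval p (($) x) = 0)}"

definition zariski_closed :: "(complex^'n) set \<Rightarrow> bool" where
  "zariski_closed V \<longleftrightarrow> (\<exists>S. (\<forall>p\<in>S. \<exists>n. form n p) \<and> V = zero_locus S)"

definition zariski_closure :: "(complex^'n) set \<Rightarrow> (complex^'n) set" where
  "zariski_closure V = zero_locus (vanishing_forms V)"

definition irreducible_variety :: "(complex^'n) set \<Rightarrow> bool" where
  "irreducible_variety V \<longleftrightarrow> zariski_closed V \<and> V \<noteq> {} \<and>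
     (\<forall>A B. zariski_closed A \<and> zariski_closed B \<and> V \<subseteq> A \<union> B \<longrightarrow> V \<subseteq> A \<or> V \<subseteq> B)"

definition variety_chain :: "(complex^'n) set \<Rightarrow> nat \<Rightarrow> bool" where
  "variety_chain V n \<longleftrightarrow> (\<exists>C :: nat \<Rightarrow> (complex^'n) set.
     (\<forall>i\<le>n. irreducible_variety (C i) \<and> C i \<subseteq> V) \<and> (\<forall>i<n. C i \<subset> C (Suc i)))"

definition has_proj_dim :: "(complex^'n) set \<Rightarrow> nat \<Rightarrow> bool" where
  "has_proj_dim V n \<longleftrightarrow> variety_chain V n \<and> \<not> variety_chain V (Suc n)"

text \<open>
  The vectors annihilated by the differentials at \<open>x\<close> of all forms vanishing on \<open>V\<close>; as a linear
  space this has one dimension more than the projective tangent space it represents.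
\<close>

definition tangent_space :: "(complex^'n) set \<Rightarrow> complex^'n \<Rightarrow> (complex^'n) set" where
  "tangent_space V x = {v. \<forall>f\<in>vanishing_forms V. deriv (\<lambda>t. peval f (($) (x + t *s v))) 0 = 0}"

definition smooth_point :: "(complex^'n) set \<Rightarrow> complex^'n \<Rightarrow> bool" where
  "smooth_point V x \<longleftrightarrow> x \<in> V \<and> (\<exists>n. has_proj_dim V n \<and> vec.dim (tangent_space V x) = n + 1)"

definition dual_variety :: "(complex^'n) set \<Rightarrow> (complex^'n) set" where
  "dual_variety V = zariski_closure
     {h. h \<noteq> 0 \<and> (\<exists>x. smooth_point V x \<and> (\<forall>v\<in>tangent_space V x. pairing h v = 0))}"

definition smooth_irreducible_curve :: "(complex^4) set \<Rightarrow> bool" where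
  "smooth_irreducible_curve X \<longleftrightarrow>
     irreducible_variety X \<and> has_proj_dim X 1 \<and> (\<forall>x\<in>X. smooth_point X x)"

text \<open>The degree of a space curve: the number of its points on a generic plane.\<close>

definition curve_degree :: "(complex^4) set \<Rightarrow> nat \<Rightarrow> bool" where
  "curve_degree X d \<longleftrightarrow> (\<exists>F :: 4 cpoly. F \<noteq> 0 \<and>
     (\<forall>h. peval F (($) h) \<noteq> 0 \<longrightarrow> finite (proj_point ` {x \<in> X. pairing h x = 0}) \<and>
        card (proj_point ` {x \<in> X. pairing h x = 0}) = d))"

definition minimal_equation :: "nat \<Rightarrow> (complex^'n) set \<Rightarrow> ('n::finite) cpoly \<Rightarrow> bool" where
  "minimal_equation m V f \<longleftrightarrow> f \<noteq> 0 \<and> form m f \<and> V = zero_locus {f} \<and>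
     (\<forall>n g. g \<noteq> 0 \<and> form n g \<and> V = zero_locus {g} \<longrightarrow> m \<le> n)"

section \<open>Cameras and dual views\<close>

definition camera_center :: "complex^4^3 \<Rightarrow> complex^4 \<Rightarrow> bool" where
  "camera_center M c \<longleftrightarrow> rank M = 3 \<and> c \<noteq> 0 \<and> M *v c = 0"

definition \<mu> :: "complex^4^3 \<Rightarrow> complex^3 \<Rightarrow> complex^4" where
  "\<mu> M l = transpose M *v l"

text \<open>
  \<open>dual_view m X M \<phi>\<close>: the center of \<open>M\<close> is off \<open>X\<close>, and \<open>\<phi>\<close> is an irreducible form of degree
  \<open>m\<close> defining the dual of the image curve of \<open>X\<close> under \<open>M\<close>.
\<close>

definition dual_view :: "nat \<Rightarrow> (complex^4) set \<Rightarrow> complex^4^3 \<Rightarrow> 3 cpoly \<Rightarrow> bool" where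
  "dual_view m X M \<phi> \<longleftrightarrow> rank M = 3 \<and> (\<forall>x\<in>X. M *v x \<noteq> 0) \<and>
     irreducible \<phi> \<and> form m \<phi> \<and> dual_variety ((*v) M ` X) = zero_locus {\<phi>}"

text \<open>
  \<open>P\<close> holds for all cameras \<open>M 0, \<dots>, M (k - 1)\<close> whose tuple of centers avoids the zeros of some
  fixed nonzero polynomial \<open>F\<close>. The restriction on the variables of \<open>F\<close> keeps \<open>F\<close> from vanishing
  at all \<open>k\<close>-tuples of centers.
\<close>

definition for_generic_centers :: "nat \<Rightarrow> ((nat \<Rightarrow> complex^4^3) \<Rightarrow> bool) \<Rightarrow> bool" where
  "for_generic_centers k P \<longleftrightarrow> (\<exists>F :: (nat \<times> 4) cpoly. F \<noteq> 0 \<and>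
     (\<forall>e\<in>Poly_Mapping.keys F. Poly_Mapping.keys e \<subseteq> {..<k} \<times> UNIV) \<and>
     (\<forall>M c. (\<forall>i<k. camera_center (M i) (c i)) \<and> peval F (\<lambda>(i, j). c i $ j) \<noteq> 0 \<longrightarrow> P M))"

definition generic_dual_degree :: "(complex^4) set \<Rightarrow> nat \<Rightarrow> bool" where
  "generic_dual_degree X m \<longleftrightarrow> for_generic_centers 1 (\<lambda>M. \<exists>\<phi>. dual_view m X (M 0) \<phi>)"

section \<open>The reconstruction equations\<close>

definition dual_solutions ::
  "nat \<Rightarrow> nat \<Rightarrow> (nat \<Rightarrow> complex^4^3) \<Rightarrow> (nat \<Rightarrow> 3 cpoly) \<Rightarrow> 4 cpoly set" where
  "dual_solutions m k M \<phi> = {G. form m G \<and>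
     (\<forall>i<k. \<exists>s. \<forall>l. peval G (($) (\<mu> (M i) l)) = s * peval (\<phi> i) (($) l))}"

text \<open>
  \<open>S\<close> is the solution set, among the forms of degree \<open>m\<close>, of \<open>q\<close> homogeneous linear equations in
  their coefficients.
\<close>

definition linear_system :: "nat \<Rightarrow> nat \<Rightarrow> 'v cpoly set \<Rightarrow> bool" where
  "linear_system m q S \<longleftrightarrow> (\<exists>a :: nat \<Rightarrow> ('v \<Rightarrow>\<^sub>0 nat) \<Rightarrow> complex.
     S = {G. form m G \<and> (\<forall>j<q. (\<Sum>e\<in>exponents m. a j e * Poly_Mapping.lookup G e) = 0)})"

text \<open>The equations of the \<open>k\<close> views determine \<open>\<Upsilon>\<close> up to a scalar.\<close>

definition linearly_reconstructs ::
  "nat \<Rightarrow> nat \<Rightarrow> (nat \<Rightarrow> complex^4^3) \<Rightarrow> (nat \<Rightarrow> 3 cpoly) \<Rightarrow> 4 cpoly \<Rightarrow> bool" where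
  "linearly_reconstructs m k M \<phi> \<Upsilon> \<longleftrightarrow>
     dual_solutions m k M \<phi> = range (\<lambda>c. Poly_Mapping.single 0 c * \<Upsilon>)"

end

theory Submission
  imports Defs "HOL-Computational_Algebra.Polynomial_Factorial"
    "HOL-Computational_Algebra.Fundamental_Theorem_Algebra" "HOL-Computational_Algebra.Field_as_Ring"
begin

text \<open>
  The equation of a view. If a line \<open>l\<close> is tangent to the image curve at the image of \<open>x\<close>, then the
  plane \<open>\<mu> M l\<close> contains the tangent line of \<open>X\<close> at \<open>x\<close>, because \<open>M\<close> maps tangent vectors of \<open>X\<close> to
  tangent vectors of the image. So \<open>\<Upsilon> \<circ> \<mu> M\<close> vanishes on the dual of the image, that is, on the
  zeros of the irreducible form \<open>\<phi>\<close>. By a Nullstellensatz for plane curves, \<open>\<phi>\<close> divides it, and as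
  both are forms of degree \<open>m\<close>, the quotient is the scalar \<open>\<lambda>\<close> (lemma \<open>dual_view_equation\<close>).

  The Nullstellensatz (lemma \<open>irreducible_form_dvd\<close>) is proved by elimination: ternary polynomials
  form the factorial ring \<open>complex poly poly poly\<close>, so if \<open>\<phi>\<close> is irreducible and does not divide \<open>G\<close>,
  some combination \<open>a * \<phi> + b * G\<close> is a nonzero polynomial \<open>R\<close> free of the main variable. Over a
  generic value of the other two variables \<open>R\<close> does not vanish, but \<open>\<phi>\<close> has a zero there, so \<open>G\<close>
  cannot vanish on all zeros of \<open>\<phi>\<close>.

  The bound. Comparing coefficients in \<open>\<Upsilon> \<circ> \<mu> M = \<lambda> * \<phi>\<close> and eliminating \<open>\<lambda>\<close> by means of one
  nonzero coefficient of \<open>\<phi>\<close> leaves one linear equation for each other monomial of degree \<open>m\<close>. A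
  system of homogeneous equations with a solution space of dimension one has at least one equation
  fewer than it has unknowns; dividing the resulting inequality by \<open>m\<close> gives the bound on \<open>k\<close>. Here
  \<open>m > 0\<close>, since the curve has tangent planes and its dual variety is therefore nonempty.

  Sufficiency. Let \<open>G\<close> solve the equations of more than \<open>m\<close> views with generic centers. On the plane
  of all \<open>h\<close> through the \<open>i\<close>-th center (a plane of the dual space, the image of \<open>\<mu> (M i)\<close>) both \<open>G\<close>
  and \<open>\<Upsilon>\<close> are multiples of the same function, and \<open>\<Upsilon>\<close> is not zero, so \<open>G = a\<^sub>i * \<Upsilon>\<close> there. Two such planes meet in a
  line on which \<open>\<Upsilon>\<close> is not identically zero, so all \<open>a\<^sub>i\<close> coincide. Then \<open>G - a * \<Upsilon>\<close> is a form of
  degree \<open>m\<close> that vanishes on more than \<open>m\<close> distinct planes, hence is zero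
  (lemmas \<open>form_vanishing_on_hyperplanes\<close> and \<open>reconstruction_from_generic_centers\<close>).
\<close>

section \<open>Evaluation of polynomials\<close>

definition monomial_at :: "('v \<Rightarrow> 'r::comm_ring_1) \<Rightarrow> ('v \<Rightarrow>\<^sub>0 nat) \<Rightarrow> 'r" where
  "monomial_at x e = (\<Prod>i\<in>Poly_Mapping.keys e. x i ^ Poly_Mapping.lookup e i)"

text \<open>
  Evaluation with values in an arbitrary commutative ring \<open>'r\<close>, the coefficients being mapped by
  \<open>h\<close>. It covers the evaluation \<open>peval\<close> at complex points and the passage to nested univariate
  polynomials.
\<close>
definition eval_in :: "(complex \<Rightarrow> 'r::comm_ring_1) \<Rightarrow> ('v \<Rightarrow> 'r) \<Rightarrow> 'v cpoly \<Rightarrow> 'r" where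
  "eval_in h x p = (\<Sum>e\<in>Poly_Mapping.keys p. h (Poly_Mapping.lookup p e) * monomial_at x e)"

lemma peval_eq_eval_in: "peval p x = eval_in id x p"
  by (simp add: peval_def eval_in_def monomial_at_def)

lemma monomial_at_superset:
  assumes "finite V" "Poly_Mapping.keys e \<subseteq> V"
  shows "monomial_at x e = (\<Prod>i\<in>V. x i ^ Poly_Mapping.lookup e i)"
  unfolding monomial_at_def using assms
  by (intro prod.mono_neutral_left) (auto simp: in_keys_iff)

lemma monomial_at_add: "monomial_at x (e + f) = monomial_at x e * monomial_at x f"
proof -
  let ?V = "Poly_Mapping.keys e \<union> Poly_Mapping.keys f"
  have "Poly_Mapping.keys (e + f) \<subseteq> ?V" by (rule keys_add)
  then show ?thesis
    by (subst (1 2 3) monomial_at_superset[of ?V])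
       (auto simp: lookup_add power_add prod.distrib)
qed

lemma monomial_at_0 [simp]: "monomial_at x 0 = 1"
  by (simp add: monomial_at_def)

lemma monomial_at_single [simp]: "monomial_at x (Poly_Mapping.single i n) = x i ^ n"
  by (simp add: monomial_at_def)

lemma sum_of_monomials:
  fixes p :: "'a \<Rightarrow>\<^sub>0 'b::comm_monoid_add"
  shows "p = (\<Sum>e\<in>Poly_Mapping.keys p. Poly_Mapping.single e (Poly_Mapping.lookup p e))"
proof (rule poly_mapping_eqI)
  fix k
  show "Poly_Mapping.lookup p k = Poly_Mapping.lookup
    (\<Sum>e\<in>Poly_Mapping.keys p. Poly_Mapping.single e (Poly_Mapping.lookup p e)) k"
    by (simp add: lookup_sum lookup_single when_def in_keys_iff sum.delta)
qed

locale coefficient_hom =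
  fixes h :: "complex \<Rightarrow> 'r::comm_ring_1"
  assumes h_add: "h (a + b) = h a + h b" and h_mult: "h (a * b) = h a * h b" and h_1: "h 1 = 1"
begin

lemma h_0: "h 0 = 0"
  using h_add[of 0 0] by simp

lemma eval_in_add: "eval_in h x (p + q) = eval_in h x p + eval_in h x q"
  unfolding eval_in_def
  by (rule setsum_keys_plus_distrib) (auto simp: h_0 h_add distrib_right)

lemma eval_in_0 [simp]: "eval_in h x 0 = 0"
  by (simp add: eval_in_def)

lemma eval_in_sum: "eval_in h x (sum f A) = (\<Sum>a\<in>A. eval_in h x (f a))"
  by (induction A rule: infinite_finite_induct) (auto simp: eval_in_add)

lemma eval_in_single: "eval_in h x (Poly_Mapping.single e c) = h c * monomial_at x e"
  by (simp add: eval_in_def h_0)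

lemma eval_in_1: "eval_in h x 1 = 1"
  using eval_in_single[of x 0 1] by (simp add: h_1)

lemma eval_in_mult: "eval_in h x (p * q) = eval_in h x p * eval_in h x q"
proof -
  have "p * q = (\<Sum>e\<in>Poly_Mapping.keys p. \<Sum>f\<in>Poly_Mapping.keys q.
      Poly_Mapping.single (e + f) (Poly_Mapping.lookup p e * Poly_Mapping.lookup q f))"
    by (subst (1 2) sum_of_monomials) (simp add: sum_product mult_single)
  then have "eval_in h x (p * q) = (\<Sum>e\<in>Poly_Mapping.keys p. \<Sum>f\<in>Poly_Mapping.keys q.
      h (Poly_Mapping.lookup p e) * monomial_at x e * (h (Poly_Mapping.lookup q f) * monomial_at x f))"
    by (simp add: eval_in_sum eval_in_single h_mult monomial_at_add mult_ac)
  then show ?thesis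
    by (simp add: eval_in_def sum_product)
qed

end

interpretation complex_eval: coefficient_hom "id :: complex \<Rightarrow> complex"
  by standard auto

lemma peval_0 [simp]: "peval 0 x = 0"
  and peval_1 [simp]: "peval 1 x = 1"
  and peval_add: "peval (p + q) x = peval p x + peval q x"
  and peval_mult: "peval (p * q) x = peval p x * peval q x"
  and peval_sum: "peval (sum f A) x = (\<Sum>a\<in>A. peval (f a) x)"
  and peval_single: "peval (Poly_Mapping.single e c) x = c * monomial_at x e"
  by (simp_all add: peval_eq_eval_in complex_eval.eval_in_add complex_eval.eval_in_mult
      complex_eval.eval_in_sum complex_eval.eval_in_single complex_eval.eval_in_1)

lemma peval_scale: "peval (Poly_Mapping.single 0 c * p) x = c * peval p x"
  by (simp add: peval_mult peval_single)

lemma lookup_scale: "Poly_Mapping.lookup (Poly_Mapping.single 0 c * p) e = c * Poly_Mapping.lookup p e"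
  by (simp add: map.rep_eq when_def flip: mult_map_scale_conv_mult)

lemma peval_diff: "peval (p - q) x = peval p x - peval q x"
  using peval_add[of "p - q" q x] by simp

lemma monomial_at_mult: "monomial_at (\<lambda>i. x i * y i) e = monomial_at x e * monomial_at y e"
  by (simp add: monomial_at_def power_mult_distrib prod.distrib)

text \<open>
  Monomials are multiplicative in the point, so this is Dedekind's theorem on the independence of
  characters: replacing \<open>x\<close> by its product with a fixed point \<open>y\<close> and subtracting a multiple of the
  original relation removes one monomial and keeps another one whose value at \<open>y\<close> differs.
\<close>
lemma monomials_independent:
  fixes a :: "('v \<Rightarrow>\<^sub>0 nat) \<Rightarrow> complex"
  assumes "finite E" "\<And>x. (\<Sum>e\<in>E. a e * monomial_at x e) = 0" "e \<in> E"
  shows "a e = 0"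
  using assms
proof (induction E arbitrary: a e rule: finite_induct)
  case empty
  then show ?case by simp
next
  case (insert e0 E)
  have zero_on_E: "a e1 = 0" if "e1 \<in> E" for e1
  proof -
    from that insert.hyps have "e1 \<noteq> e0" by auto
    then obtain i where i: "Poly_Mapping.lookup e1 i \<noteq> Poly_Mapping.lookup e0 i"
      by (metis poly_mapping_eqI)
    \<comment> \<open>The value of a monomial at \<open>y\<close> is a power of 2 that reveals the exponent of the variable \<open>i\<close>.\<close>
    define y :: "'v \<Rightarrow> complex" where "y = (\<lambda>j. if j = i then 2 else 1)"
    have y: "monomial_at y e = 2 ^ Poly_Mapping.lookup e i" for e
    proof -
      have "monomial_at y e = (\<Prod>j\<in>insert i (Poly_Mapping.keys e). y j ^ Poly_Mapping.lookup e j)"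
        by (rule monomial_at_superset) auto
      also have "\<dots> = y i ^ Poly_Mapping.lookup e i * (\<Prod>j\<in>Poly_Mapping.keys e - {i}. y j ^ Poly_Mapping.lookup e j)"
        by (simp add: prod.insert_remove)
      also have "(\<Prod>j\<in>Poly_Mapping.keys e - {i}. y j ^ Poly_Mapping.lookup e j) = 1"
        by (rule prod.neutral) (auto simp: y_def)
      finally show ?thesis by (simp add: y_def)
    qed
    have ne: "monomial_at y e1 \<noteq> monomial_at y e0"
    proof
      assume "monomial_at y e1 = monomial_at y e0"
      then have "norm ((2::complex) ^ Poly_Mapping.lookup e1 i) = norm ((2::complex) ^ Poly_Mapping.lookup e0 i)"
        by (simp only: y)
      then have "(2::real) ^ Poly_Mapping.lookup e1 i = 2 ^ Poly_Mapping.lookup e0 i"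
        by (simp only: norm_power norm_numeral)
      with i show False by simp
    qed
    have "(\<Sum>e\<in>E. (a e * (monomial_at y e - monomial_at y e0)) * monomial_at x e) = 0" for x
    proof -
      have "(\<Sum>e\<in>insert e0 E. a e * monomial_at (\<lambda>i. x i * y i) e)
          - monomial_at y e0 * (\<Sum>e\<in>insert e0 E. a e * monomial_at x e) = 0"
        by (simp add: insert.prems(1) del: sum.insert)
      then show ?thesis
        using insert.hyps
        by (simp add: monomial_at_mult sum_distrib_left algebra_simps sum_subtractf)
    qed
    from insert.IH[OF this that] ne show ?thesis by simp
  qed
  have "a e0 * monomial_at (\<lambda>_. 1) e0 = 0"
    using insert.prems(1)[of "\<lambda>_. 1"] insert.hyps zero_on_E by simp
  then have "a e0 = 0" by (simp add: monomial_at_def)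
  with zero_on_E insert.prems show ?case by auto
qed

lemma peval_eq_0_iff: "(\<forall>x. peval p x = 0) \<longleftrightarrow> p = 0"
proof
  assume *: "\<forall>x. peval p x = 0"
  have "Poly_Mapping.lookup p e = 0" if "e \<in> Poly_Mapping.keys p" for e
    using monomials_independent[of "Poly_Mapping.keys p" "Poly_Mapping.lookup p" e] * that
    by (simp add: peval_def monomial_at_def)
  then show "p = 0"
    by (intro poly_mapping_eqI) (metis lookup_zero in_keys_iff)
qed simp

lemma nonzero_value:
  assumes "p \<noteq> 0"
  obtains x where "peval p x \<noteq> 0"
  using assms unfolding peval_eq_0_iff[symmetric] by blast

lemma peval_inject: "(\<And>x. peval p x = peval q x) \<Longrightarrow> p = q"
  using peval_eq_0_iff[of "p - q"] by (simp add: peval_diff)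

section \<open>Forms, polynomial functions and genericity\<close>

lemma lookup_sum_keys_superset:
  assumes "finite V" "Poly_Mapping.keys e \<subseteq> V"
  shows "(\<Sum>i\<in>Poly_Mapping.keys e. Poly_Mapping.lookup e i) = (\<Sum>i\<in>V. Poly_Mapping.lookup e i)"
  using assms by (intro sum.mono_neutral_left) (auto simp: in_keys_iff)

lemma exponents_add:
  assumes "e \<in> exponents a" "f \<in> exponents b"
  shows "e + f \<in> exponents (a + b)"
proof -
  let ?V = "Poly_Mapping.keys e \<union> Poly_Mapping.keys f"
  have "Poly_Mapping.keys (e + f) \<subseteq> ?V" by (rule keys_add)
  then show ?thesis
    using assms lookup_sum_keys_superset[of ?V e] lookup_sum_keys_superset[of ?V f]
      lookup_sum_keys_superset[of ?V "e + f"]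
    by (simp add: exponents_def lookup_add sum.distrib)
qed

lemma form_0 [simp]: "form n 0"
  by (simp add: form_def)

lemma form_add: "form n p \<Longrightarrow> form n q \<Longrightarrow> form n (p + q)"
  using keys_add[of p q] by (auto simp: form_def)

lemma form_mult: "form a p \<Longrightarrow> form b q \<Longrightarrow> form (a + b) (p * q)"
proof -
  assume "form a p" "form b q"
  then have "x + y \<in> exponents (a + b)" if "x \<in> Poly_Mapping.keys p" "y \<in> Poly_Mapping.keys q" for x y
    using that by (auto simp: form_def intro: exponents_add)
  with keys_mult[of p q] show ?thesis unfolding form_def by blast
qed

lemma form_const: "form 0 (Poly_Mapping.single 0 c)"
  by (auto simp: form_def exponents_def)

lemma form_var: "form 1 (Poly_Mapping.single (Poly_Mapping.single i 1) c)"
  by (auto simp: form_def exponents_def)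

lemma form_scale: "form n p \<Longrightarrow> form n (Poly_Mapping.single 0 c * p)"
  using form_mult[OF form_const] by force

lemma form_diff: "form n p \<Longrightarrow> form n q \<Longrightarrow> form n (p - q)"
  unfolding form_def using keys_diff[of p q] by blast

lemma form_sum: "(\<And>a. a \<in> A \<Longrightarrow> form n (f a)) \<Longrightarrow> form n (\<Sum>a\<in>A. f a)"
  by (induction A rule: infinite_finite_induct) (auto intro: form_add)

text \<open>
  On the level of functions, compositions of forms with linear maps can be recognized as forms
  without computing their coefficients.
\<close>
definition form_fun :: "nat \<Rightarrow> (('v \<Rightarrow> complex) \<Rightarrow> complex) \<Rightarrow> bool" where
  "form_fun n f \<longleftrightarrow> (\<exists>p. form n p \<and> (\<forall>x. peval p x = f x))"

lemma form_fun_zero: "form_fun n (\<lambda>x. 0)"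
  unfolding form_fun_def by (intro exI[of _ 0]) simp

lemma form_fun_const: "form_fun 0 (\<lambda>x. c)"
  unfolding form_fun_def
  by (intro exI[of _ "Poly_Mapping.single 0 c"]) (simp add: form_const peval_single)

lemma form_fun_var: "form_fun 1 (\<lambda>x. x i)"
  unfolding form_fun_def
  by (rule exI[of _ "Poly_Mapping.single (Poly_Mapping.single i 1) 1"])
     (use form_var[of i 1] in \<open>simp add: peval_single\<close>)

lemma form_fun_add: "form_fun n f \<Longrightarrow> form_fun n g \<Longrightarrow> form_fun n (\<lambda>x. f x + g x)"
  unfolding form_fun_def by (metis form_add peval_add)

lemma form_fun_mult: "form_fun a f \<Longrightarrow> form_fun b g \<Longrightarrow> form_fun (a + b) (\<lambda>x. f x * g x)"
  unfolding form_fun_def by (metis form_mult peval_mult)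

lemma form_fun_scale: "form_fun n f \<Longrightarrow> form_fun n (\<lambda>x. c * f x)"
  using form_fun_mult[OF form_fun_const, of n f c] by simp

lemma form_fun_sum:
  "(\<And>a. a \<in> A \<Longrightarrow> form_fun n (f a)) \<Longrightarrow> form_fun n (\<lambda>x. \<Sum>a\<in>A. f a x)"
  by (induction A rule: infinite_finite_induct) (auto intro: form_fun_zero form_fun_add)

lemma form_fun_power: "form_fun n f \<Longrightarrow> form_fun (k * n) (\<lambda>x. f x ^ k)"
proof (induction k)
  case 0
  then show ?case using form_fun_const[of 1] by simp
next
  case (Suc k)
  then show ?case using form_fun_mult[of n f "k * n" "\<lambda>x. f x ^ k"] by simp
qed

lemma form_fun_prod:
  "finite A \<Longrightarrow> (\<And>a. a \<in> A \<Longrightarrow> form_fun (n a) (f a)) \<Longrightarrow> form_fun (\<Sum>a\<in>A. n a) (\<lambda>x. \<Prod>a\<in>A. f a x)"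
proof (induction A rule: finite_induct)
  case empty
  then show ?case using form_fun_const[of 1] by simp
next
  case (insert a A)
  then show ?case using form_fun_mult[of "n a" "f a" "\<Sum>a\<in>A. n a" "\<lambda>x. \<Prod>a\<in>A. f a x"] by simp
qed

lemma form_fun_monomial_compose:
  assumes "e \<in> exponents n" "\<And>i. form_fun 1 (L i)"
  shows "form_fun n (\<lambda>y. monomial_at (\<lambda>i. L i y) e)"
proof -
  have "form_fun (\<Sum>i\<in>Poly_Mapping.keys e. Poly_Mapping.lookup e i * 1)
     (\<lambda>y. \<Prod>i\<in>Poly_Mapping.keys e. L i y ^ Poly_Mapping.lookup e i)"
    by (intro form_fun_prod form_fun_power assms) simp
  with assms(1) show ?thesis
    by (simp add: exponents_def monomial_at_def)
qed

lemma peval_monomials: "peval p x = (\<Sum>e\<in>Poly_Mapping.keys p. Poly_Mapping.lookup p e * monomial_at x e)"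
  by (simp add: peval_def monomial_at_def)

lemma form_fun_compose:
  assumes "form n p" "\<And>i. form_fun 1 (L i)"
  shows "form_fun n (\<lambda>y. peval p (\<lambda>i. L i y))"
  unfolding peval_monomials using assms
  by (intro form_fun_sum form_fun_scale form_fun_monomial_compose) (auto simp: form_def)

lemma peval_scaled_argument:
  assumes "form n p"
  shows "peval p (\<lambda>i. t * x i) = t ^ n * peval p x"
proof -
  have "monomial_at (\<lambda>i. t * x i) e = t ^ n * monomial_at x e" if "e \<in> Poly_Mapping.keys p" for e
  proof -
    have "(\<Sum>i\<in>Poly_Mapping.keys e. Poly_Mapping.lookup e i) = n"
      using that assms by (auto simp: form_def exponents_def)
    then show ?thesis
      unfolding monomial_at_def by (simp add: power_mult_distrib prod.distrib flip: power_sum)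
  qed
  then show ?thesis
    by (simp add: peval_monomials sum_distrib_left mult_ac)
qed

lemma peval_zero_vector: "form n p \<Longrightarrow> n > 0 \<Longrightarrow> peval p (\<lambda>i. 0) = 0"
  using peval_scaled_argument[of n p 0 "\<lambda>i. 0"] by (simp add: zero_power)

text \<open>
  Restriction to a line turns questions about forms into questions about roots of univariate
  polynomials.
\<close>
lemma peval_on_line:
  "\<exists>P. (\<forall>t. poly P t = peval p (\<lambda>i. x i + t * y i)) \<and> (\<forall>n. form n p \<longrightarrow> degree P \<le> n)"
proof -
  define P where "P = (\<Sum>e\<in>Poly_Mapping.keys p. smult (Poly_Mapping.lookup p e)
     (\<Prod>i\<in>Poly_Mapping.keys e. [:x i, y i:] ^ Poly_Mapping.lookup e i))"
  have "poly P t = peval p (\<lambda>i. x i + t * y i)" for t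
    by (simp add: P_def peval_def poly_sum poly_prod)
  moreover have "degree P \<le> n" if "form n p" for n
    unfolding P_def
  proof (intro degree_sum_le order.trans[OF degree_smult_le] finite_keys)
    fix e assume "e \<in> Poly_Mapping.keys p"
    with that have n: "(\<Sum>i\<in>Poly_Mapping.keys e. Poly_Mapping.lookup e i) = n"
      by (auto simp: form_def exponents_def)
    have "degree (\<Prod>i\<in>Poly_Mapping.keys e. [:x i, y i:] ^ Poly_Mapping.lookup e i)
       \<le> (\<Sum>i\<in>Poly_Mapping.keys e. degree ([:x i, y i:] ^ Poly_Mapping.lookup e i))"
      by (rule order.trans[OF degree_prod_sum_le]) auto
    also have "\<dots> \<le> (\<Sum>i\<in>Poly_Mapping.keys e. Poly_Mapping.lookup e i)"
    proof (rule sum_mono)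
      fix i
      have "degree ([:x i, y i:] ^ Poly_Mapping.lookup e i) \<le> degree [:x i, y i:] * Poly_Mapping.lookup e i"
        by (rule degree_power_le)
      also have "\<dots> \<le> 1 * Poly_Mapping.lookup e i"
        by (intro mult_right_mono) auto
      finally show "degree ([:x i, y i:] ^ Poly_Mapping.lookup e i) \<le> Poly_Mapping.lookup e i" by simp
    qed
    finally show "degree (\<Prod>i\<in>Poly_Mapping.keys e. [:x i, y i:] ^ Poly_Mapping.lookup e i) \<le> n"
      using n by simp
  qed
  ultimately show ?thesis by blast
qed

text \<open>
  On the line that joins a point where \<open>p\<close> does not vanish to a point where \<open>q\<close> does not vanish,
  both restrict to nonzero univariate polynomials.
\<close>
lemma cpoly_mult_nonzero:
  fixes p q :: "'v cpoly"
  assumes "p \<noteq> 0" "q \<noteq> 0"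
  shows "p * q \<noteq> 0"
proof -
  obtain x where x: "peval p x \<noteq> 0" by (rule nonzero_value[OF assms(1)])
  obtain y where y: "peval q y \<noteq> 0" by (rule nonzero_value[OF assms(2)])
  obtain P where P: "\<forall>t. poly P t = peval p (\<lambda>i. x i + t * (y i - x i))"
    using peval_on_line[of p x "\<lambda>i. y i - x i"] by blast
  obtain Q where Q: "\<forall>t. poly Q t = peval q (\<lambda>i. x i + t * (y i - x i))"
    using peval_on_line[of q x "\<lambda>i. y i - x i"] by blast
  from P[rule_format, of 0] x have "P \<noteq> 0" by auto
  moreover from Q[rule_format, of 1] y have "Q \<noteq> 0" by auto
  ultimately have "P * Q \<noteq> 0" by simp
  then obtain t where "poly (P * Q) t \<noteq> 0"
    using poly_all_0_iff_0 by blast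
  then show ?thesis
    by (auto simp: P Q simp flip: peval_mult)
qed

lemma cpoly_prod_nonzero: "(\<And>a. a \<in> A \<Longrightarrow> p a \<noteq> 0) \<Longrightarrow> (\<Prod>a\<in>A. p a) \<noteq> (0 :: 'v cpoly)"
  by (induction A rule: infinite_finite_induct) (auto simp: cpoly_mult_nonzero)

lemma peval_prod: "peval (\<Prod>a\<in>A. p a) x = (\<Prod>a\<in>A. peval (p a) x)"
  by (induction A rule: infinite_finite_induct) (auto simp: peval_mult)

text \<open>
  The set \<open>V\<close> serves to express that a condition on a tuple of camera centers concerns only the
  first \<open>k\<close> of them.
\<close>
definition poly_fun :: "'v set \<Rightarrow> (('v \<Rightarrow> complex) \<Rightarrow> complex) \<Rightarrow> bool" where
  "poly_fun V f \<longleftrightarrow> (\<exists>p. (\<forall>e\<in>Poly_Mapping.keys p. Poly_Mapping.keys e \<subseteq> V) \<and> (\<forall>x. peval p x = f x))"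

lemma poly_fun_const: "poly_fun V (\<lambda>x. c)"
  unfolding poly_fun_def
  by (rule exI[of _ "Poly_Mapping.single 0 c"]) (simp add: peval_single)

lemma poly_fun_var: "i \<in> V \<Longrightarrow> poly_fun V (\<lambda>x. x i)"
  unfolding poly_fun_def
  by (rule exI[of _ "Poly_Mapping.single (Poly_Mapping.single i 1) 1"]) (simp add: peval_single)

lemma poly_fun_add:
  assumes "poly_fun V f" "poly_fun V g" shows "poly_fun V (\<lambda>x. f x + g x)"
proof -
  from assms obtain p q where "\<forall>e\<in>Poly_Mapping.keys p. Poly_Mapping.keys e \<subseteq> V" "\<forall>x. peval p x = f x"
    "\<forall>e\<in>Poly_Mapping.keys q. Poly_Mapping.keys e \<subseteq> V" "\<forall>x. peval q x = g x"
    unfolding poly_fun_def by blast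
  moreover from this keys_add[of p q] have "\<forall>e\<in>Poly_Mapping.keys (p + q). Poly_Mapping.keys e \<subseteq> V"
    by blast
  ultimately show ?thesis
    unfolding poly_fun_def by (intro exI[of _ "p + q"]) (simp add: peval_add)
qed

lemma poly_fun_mult:
  assumes "poly_fun V f" "poly_fun V g" shows "poly_fun V (\<lambda>x. f x * g x)"
proof -
  from assms obtain p q where p: "\<forall>e\<in>Poly_Mapping.keys p. Poly_Mapping.keys e \<subseteq> V" "\<forall>x. peval p x = f x"
    and q: "\<forall>e\<in>Poly_Mapping.keys q. Poly_Mapping.keys e \<subseteq> V" "\<forall>x. peval q x = g x"
    unfolding poly_fun_def by blast
  have "Poly_Mapping.keys e \<subseteq> V" if e: "e \<in> Poly_Mapping.keys (p * q)" for e
  proof -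
    from e keys_mult[of p q] obtain a b where "e = a + b" "a \<in> Poly_Mapping.keys p" "b \<in> Poly_Mapping.keys q"
      by blast
    with p q keys_add[of a b] show ?thesis by blast
  qed
  with p q show ?thesis
    unfolding poly_fun_def by (intro exI[of _ "p * q"]) (auto simp: peval_mult)
qed

lemma poly_fun_diff:
  assumes "poly_fun V f" "poly_fun V g" shows "poly_fun V (\<lambda>x. f x - g x)"
  using poly_fun_add[OF assms(1) poly_fun_mult[OF poly_fun_const[of V "- 1"] assms(2)]] by simp

lemma poly_fun_sum: "(\<And>a. a \<in> A \<Longrightarrow> poly_fun V (f a)) \<Longrightarrow> poly_fun V (\<lambda>x. \<Sum>a\<in>A. f a x)"
  by (induction A rule: infinite_finite_induct) (auto intro: poly_fun_const poly_fun_add)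

lemma poly_fun_prod: "(\<And>a. a \<in> A \<Longrightarrow> poly_fun V (f a)) \<Longrightarrow> poly_fun V (\<lambda>x. \<Prod>a\<in>A. f a x)"
  by (induction A rule: infinite_finite_induct) (auto intro: poly_fun_const poly_fun_mult)

lemma poly_fun_if: "poly_fun V f \<Longrightarrow> poly_fun V g \<Longrightarrow> poly_fun V (\<lambda>x. if P then f x else g x)"
  by (cases P) auto

lemma poly_fun_power: "poly_fun V f \<Longrightarrow> poly_fun V (\<lambda>x. f x ^ n)"
  by (induction n) (auto intro: poly_fun_const poly_fun_mult)

lemma poly_fun_compose:
  assumes "\<And>e i. e \<in> Poly_Mapping.keys p \<Longrightarrow> i \<in> Poly_Mapping.keys e \<Longrightarrow> poly_fun V (L i)"
  shows "poly_fun V (\<lambda>y. peval p (\<lambda>i. L i y))"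
  unfolding peval_def using assms
  by (intro poly_fun_sum poly_fun_mult poly_fun_const poly_fun_prod poly_fun_power)

text \<open>
  Finitely many polynomial conditions, each of which can be met, can be met together outside the
  zeros of one polynomial, namely the product of the given ones.
\<close>
lemma poly_fun_family_generic:
  assumes "finite A" "\<And>a. a \<in> A \<Longrightarrow> poly_fun V (f a)" "\<And>a. a \<in> A \<Longrightarrow> \<exists>x. f a x \<noteq> 0"
  shows "\<exists>F. F \<noteq> 0 \<and> (\<forall>e\<in>Poly_Mapping.keys F. Poly_Mapping.keys e \<subseteq> V) \<and>
    (\<forall>x. peval F x \<noteq> 0 \<longrightarrow> (\<forall>a\<in>A. f a x \<noteq> 0))"
proof -
  have "\<exists>p. \<forall>x. peval p x = f a x" if "a \<in> A" for a
    using assms(2)[OF that] by (auto simp: poly_fun_def)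
  then obtain p where p: "\<forall>a\<in>A. \<forall>x. peval (p a) x = f a x"
    using bchoice[of A "\<lambda>a p. \<forall>x. peval p x = f a x"] by blast
  have "p a \<noteq> 0" if "a \<in> A" for a
    using assms(3)[OF that] p that by fastforce
  then have "(\<Prod>a\<in>A. p a) \<noteq> 0" by (rule cpoly_prod_nonzero)
  then obtain z where "peval (\<Prod>a\<in>A. p a) z \<noteq> 0" by (rule nonzero_value)
  then have z: "(\<Prod>a\<in>A. f a z) \<noteq> 0" using p by (simp add: peval_prod)
  obtain F where F: "\<forall>e\<in>Poly_Mapping.keys F. Poly_Mapping.keys e \<subseteq> V" "\<forall>x. peval F x = (\<Prod>a\<in>A. f a x)"
    using poly_fun_prod[of A V f] assms(2) by (auto simp: poly_fun_def)
  with z have "F \<noteq> 0" by auto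
  with F assms(1) show ?thesis by (intro exI[of _ F]) auto
qed

section \<open>Irreducible ternary forms are determined by their zeros\<close>

text \<open>
  This replaces the resultant. An element \<open>r\<close> of least degree in the ideal generated by \<open>f\<close> and \<open>g\<close>
  divides \<open>f\<close> and \<open>g\<close> up to constant factors, by pseudo-division. If \<open>r\<close> were not constant, the
  prime element \<open>f\<close> would divide \<open>r\<close>, and therefore \<open>g\<close>.
\<close>
lemma coprime_elimination:
  fixes f g :: "'a::{factorial_ring_gcd, semiring_gcd_mult_normalize} poly"
  assumes "irreducible f" "degree f > 0" "\<not> f dvd g"
  obtains a b c where "a * f + b * g = [:c:]" "c \<noteq> 0"
proof -
  define I where "I = {r. \<exists>a b. a * f + b * g = r}"
  have I_comb: "u * r - v * s \<in> I" if "r \<in> I" "s \<in> I" for u v r s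
  proof -
    from that obtain a b a' b' where "r = a * f + b * g" "s = a' * f + b' * g"
      by (auto simp: I_def)
    then have "(u * a - v * a') * f + (u * b - v * b') * g = u * r - v * s"
      by (simp add: algebra_simps)
    then show ?thesis by (auto simp: I_def)
  qed
  have f_I: "f \<in> I" unfolding I_def by (rule CollectI, rule exI[of _ 1], rule exI[of _ 0]) simp
  have g_I: "g \<in> I" unfolding I_def by (rule CollectI, rule exI[of _ 0], rule exI[of _ 1]) simp
  have "f \<noteq> 0" using assms(2) by auto
  then obtain r where r: "r \<in> I" "r \<noteq> 0" and r_min: "\<And>s. s \<in> I \<Longrightarrow> s \<noteq> 0 \<Longrightarrow> degree r \<le> degree s"
    using ex_has_least_nat[of "\<lambda>r. r \<in> I \<and> r \<noteq> 0" f degree] f_I by auto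
  have r_divides: "\<exists>a q. a \<noteq> 0 \<and> smult a p = r * q" if "p \<in> I" for p
  proof -
    obtain a q where aq: "a \<noteq> 0" "smult a p = r * q + pseudo_mod p r"
      using pseudo_mod(1)[OF r(2)] by blast
    have "pseudo_mod p r = [:a:] * p - q * r"
      using aq(2) by (simp add: mult.commute)
    then have "pseudo_mod p r \<in> I"
      using I_comb that r(1) by presburger
    with pseudo_mod(2)[OF r(2), of p] r_min have "pseudo_mod p r = 0"
      by force
    with aq show ?thesis by auto
  qed
  have prime: "prime_elem f"
    using assms(1) by (rule irreducible_imp_prime_elem)
  have not_const: "\<not> f dvd [:c:]" if "c \<noteq> 0" for c
    using that assms(2) by (auto dest: dvd_imp_degree_le)
  have "degree r = 0"
  proof -
    obtain a q where a: "a \<noteq> 0" "smult a f = r * q" using r_divides[OF f_I] by blast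
    then have "f dvd r * q" by (metis dvd_smult dvd_refl)
    then consider "f dvd q" | "f dvd r" using prime prime_elem_dvd_mult_iff by blast
    then show ?thesis
    proof cases
      case 1
      then obtain t where t: "q = f * t" by (elim dvdE)
      from a have "f * [:a:] = f * (r * t)" by (simp add: t mult_ac)
      with \<open>f \<noteq> 0\<close> have "[:a:] = r * t" unfolding mult_cancel_left by blast
      moreover from this a(1) have "t \<noteq> 0" by auto
      ultimately have "degree r + degree t = 0"
        using r(2) by (metis degree_mult_eq degree_pCons_0)
      then show ?thesis by simp
    next
      case 2
      obtain b q' where b: "b \<noteq> 0" "smult b g = r * q'" using r_divides[OF g_I] by blast
      with 2 have "f dvd [:b:] * g" by simp
      with prime prime_elem_dvd_mult_iff not_const[OF b(1)] assms(3) show ?thesis by blast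
    qed
  qed
  then obtain c where "r = [:c:]" by (rule degree_eq_zeroE)
  with r that show ?thesis by (auto simp: I_def)
qed

definition const3 :: "complex \<Rightarrow> complex poly poly poly" where
  "const3 c = [:[:[:c:]:]:]"

interpretation const3: coefficient_hom const3
  by standard (simp_all add: const3_def one_pCons)

text \<open>
  For three variables \<open>u\<close>, \<open>v\<close>, \<open>w\<close> the variable \<open>u\<close> becomes the outermost one and \<open>w\<close> the innermost
  one.
\<close>
definition nested_var :: "'v \<Rightarrow> 'v \<Rightarrow> 'v \<Rightarrow> complex poly poly poly" where
  "nested_var u v i = (if i = u then [:0, 1:] else if i = v then [:[:0, 1:]:] else [:[:[:0, 1:]:]:])"

definition nested :: "'v \<Rightarrow> 'v \<Rightarrow> 'v cpoly \<Rightarrow> complex poly poly poly" where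
  "nested u v = eval_in const3 (nested_var u v)"

lemma poly_nested:
  fixes p :: "'v cpoly"
  assumes "UNIV = {u, v, w}" "u \<noteq> v" "u \<noteq> w" "v \<noteq> w"
  shows "poly (poly (poly (nested u v p) [:[:x u:]:]) [:x v:]) (x w) = peval p x"
proof -
  have "poly (poly (poly (nested_var u v i) [:[:x u:]:]) [:x v:]) (x w) = x i" for i
    using assms by (cases "i = u"; cases "i = v"; cases "i = w") (auto simp: nested_var_def)
  then show ?thesis
    by (simp add: nested_def eval_in_def peval_def monomial_at_def poly_sum poly_prod const3_def)
qed

lemma nested_mult: "nested u v (p * q) = nested u v p * nested u v q"
  by (simp add: nested_def const3.eval_in_mult)

lemma nested_1: "nested u v 1 = 1"
  by (simp add: nested_def const3.eval_in_1)

lemma nested_inject: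
  assumes "(UNIV :: 'v set) = {u, v, w}" "u \<noteq> v" "u \<noteq> w" "v \<noteq> w" "nested u v p = nested u v q"
  shows "p = (q :: 'v cpoly)"
  using poly_nested[OF assms(1-4)] assms(5) by (intro peval_inject) metis

text \<open>
  The range of a ring homomorphism contains with the constants and the variables everything that is
  built from them by sums and products. With injectivity, \<open>nested u v\<close> is a ring isomorphism, so it
  preserves irreducibility.
\<close>
lemma nested_surj:
  assumes "(UNIV :: 'v set) = {u, v, w}" "u \<noteq> v" "u \<noteq> w" "v \<noteq> w"
  shows "\<exists>p :: 'v cpoly. nested u v p = P"
proof -
  let ?R = "range (nested u v :: 'v cpoly \<Rightarrow> _)"
  have add: "P + Q \<in> ?R" if "P \<in> ?R" "Q \<in> ?R" for P Q
    using that by (auto simp: nested_def simp flip: const3.eval_in_add)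
  have mult: "P * Q \<in> ?R" if "P \<in> ?R" "Q \<in> ?R" for P Q
    using that by (auto simp flip: nested_mult)
  have const: "const3 c \<in> ?R" for c
    by (rule range_eqI[of _ _ "Poly_Mapping.single 0 c"]) (simp add: nested_def const3.eval_in_single)
  have var: "nested_var u v i \<in> ?R" for i
    by (rule range_eqI[of _ _ "Poly_Mapping.single (Poly_Mapping.single i 1) 1"])
       (simp add: nested_def const3.eval_in_single const3.h_1)
  have X: "[:0, 1:] \<in> ?R" "[:[:0, 1:]:] \<in> ?R" "[:[:[:0, 1:]:]:] \<in> ?R"
    using var[of u] var[of v] var[of w] assms(2-4) by (auto simp: nested_var_def)
  have 1: "[:[:a:]:] \<in> ?R" for a
  proof (induction a)
    case 0
    show ?case using const[of 0] by (simp add: const3_def)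
  next
    case (pCons c a)
    have "[:[:pCons c a:]:] = const3 c + [:[:[:0, 1:]:]:] * [:[:a:]:]"
      by (simp add: const3_def)
    then show ?case using add[OF const mult[OF X(3) pCons.IH]] by metis
  qed
  have 2: "[:b:] \<in> ?R" for b
  proof (induction b)
    case 0
    show ?case using const[of 0] by (simp add: const3_def)
  next
    case (pCons c a)
    have "[:pCons c a:] = [:[:c:]:] + [:[:0, 1:]:] * [:a:]"
      by simp
    then show ?case using add[OF 1 mult[OF X(2) pCons.IH]] by metis
  qed
  have "P \<in> ?R"
  proof (induction P)
    case 0
    show ?case using const[of 0] by (simp add: const3_def)
  next
    case (pCons c a)
    have "pCons c a = [:c:] + [:0, 1:] * a"
      by simp
    then show ?case using add[OF 2 mult[OF X(1) pCons.IH]] by metis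
  qed
  then show ?thesis by force
qed

lemma irreducible_nested:
  fixes p :: "'v cpoly"
  assumes "UNIV = {u, v, w}" "u \<noteq> v" "u \<noteq> w" "v \<noteq> w" "irreducible p"
  shows "irreducible (nested u v p)"
proof (rule irreducibleI)
  note inj = nested_inject[OF assms(1-4)] and surj = nested_surj[OF assms(1-4)]
  have unit: "P dvd 1 \<longleftrightarrow> p dvd 1" if P: "nested u v p = P" for P and p :: "'v cpoly"
  proof
    assume "P dvd 1"
    then obtain Q where "1 = P * Q" by (elim dvdE)
    moreover obtain q :: "'v cpoly" where "nested u v q = Q" using surj by blast
    ultimately have "nested u v 1 = nested u v (p * q)" using P by (simp add: nested_1 nested_mult)
    then show "p dvd 1" using inj by (metis dvdI)
  next
    assume "p dvd 1"
    then obtain q where "1 = p * q" by (elim dvdE)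
    then have "1 = P * nested u v q" using P by (metis nested_1 nested_mult)
    then show "P dvd 1" by (rule dvdI)
  qed
  show "nested u v p \<noteq> 0"
    using assms(5) inj[of p 0] by (auto simp: nested_def)
  show "\<not> nested u v p dvd 1"
    using assms(5) unit by (auto simp: irreducible_def)
  fix A B assume AB: "nested u v p = A * B"
  obtain a b :: "'v cpoly" where ab: "nested u v a = A" "nested u v b = B" using surj by metis
  with AB have "p = a * b" using inj by (metis nested_mult)
  with assms(5) have "a dvd 1 \<or> b dvd 1" by (auto simp: irreducible_def)
  with unit ab show "A dvd 1 \<or> B dvd 1" by blast
qed

lemma exhaust_3_distinct: fixes u :: 3 obtains v w where "UNIV = {u, v, w}" "u \<noteq> v" "u \<noteq> w" "v \<noteq> w"
proof -
  have U: "(UNIV :: 3 set) = {1, 2, 3}" "(1::3) \<noteq> 2" "(1::3) \<noteq> 3" "(2::3) \<noteq> 3"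
    using UNIV_3 by auto
  then consider "u = 1" | "u = 2" | "u = 3" by auto
  then show thesis
    using U that[of 2 3] that[of 1 3] that[of 1 2] by cases auto
qed

text \<open>
  A nonzero form of positive degree is not constant, since it vanishes at the origin. Setting the
  coordinates to zero one after the other, its value changes at some step.
\<close>
lemma depends_on_some_variable:
  fixes p :: "3 cpoly"
  assumes "p \<noteq> 0" "form m p" "m > 0"
  obtains u x x' where "\<forall>i. i \<noteq> u \<longrightarrow> x i = x' i" "peval p x \<noteq> peval p x'"
proof -
  obtain x where x: "peval p x \<noteq> 0" by (rule nonzero_value[OF assms(1)])
  \<comment> \<open>\<open>y k\<close> arises from \<open>x\<close> by setting the first \<open>k\<close> coordinates to zero.\<close>
  define y where "y k = (\<lambda>i::3. if i = 1 \<and> k \<ge> 1 \<or> i = 2 \<and> k \<ge> 2 \<or> i = 3 \<and> k \<ge> 3 then 0 else x i)" for k :: nat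
  have "y 3 = (\<lambda>i. 0)" "y 0 = x"
    using exhaust_3 by (auto simp: y_def fun_eq_iff)
  with peval_zero_vector[OF assms(2,3)] x have "peval p (y 0) \<noteq> peval p (y 3)" by simp
  then consider "peval p (y 0) \<noteq> peval p (y 1)" | "peval p (y 1) \<noteq> peval p (y 2)" | "peval p (y 2) \<noteq> peval p (y 3)"
    by force
  then show thesis
  proof cases
    case 1 then show ?thesis by (intro that[of 1 "y 0" "y 1"]) (auto simp: y_def)
  next
    case 2 then show ?thesis by (intro that[of 2 "y 1" "y 2"]) (auto simp: y_def)
  next
    case 3 then show ?thesis by (intro that[of 3 "y 2" "y 3"]) (auto simp: y_def)
  qed
qed

lemma nonzero_value_2:
  fixes L :: "complex poly poly"
  assumes "L \<noteq> 0"
  obtains b a where "poly (poly L [:b:]) a \<noteq> 0"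
proof -
  have "infinite (range (\<lambda>b :: complex. [:b:]))"
    by (subst finite_image_iff) (auto simp: inj_on_def infinite_UNIV_char_0)
  then have "\<not> range (\<lambda>b. [:b:]) \<subseteq> {C. poly L C = 0}"
    using poly_roots_finite[OF assms] finite_subset by blast
  then obtain b where "poly L [:b:] \<noteq> 0" by blast
  then obtain a where "poly (poly L [:b:]) a \<noteq> 0" using poly_all_0_iff_0 by blast
  then show thesis by (rule that)
qed

text \<open>
  Nullstellensatz for one irreducible equation. The main variable is one on which \<open>f\<close> depends, so
  that \<open>f\<close> has positive degree in it and elimination applies. The remaining variables are chosen
  such that neither the eliminant nor the leading coefficient of \<open>f\<close> vanishes; then \<open>f\<close> has a zero
  there by the fundamental theorem of algebra.
\<close>
lemma irreducible_form_dvd: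
  fixes f g :: "3 cpoly"
  assumes "irreducible f" "form m f" "m > 0" "\<And>x. peval f x = 0 \<Longrightarrow> peval g x = 0"
  shows "f dvd g"
proof (rule ccontr)
  assume ndvd: "\<not> f dvd g"
  have "f \<noteq> 0" using assms(1) by auto
  then obtain u and x1 x2 :: "3 \<Rightarrow> complex" where dep: "\<forall>i. i \<noteq> u \<longrightarrow> x1 i = x2 i" "peval f x1 \<noteq> peval f x2"
    by (rule depends_on_some_variable[OF _ assms(2,3)])
  obtain v w where uvw: "UNIV = {u, v, w}" "u \<noteq> v" "u \<noteq> w" "v \<noteq> w"
    by (rule exhaust_3_distinct)
  note nested = poly_nested[OF uvw]
  let ?F = "nested u v f" and ?G = "nested u v g"
  have "degree ?F > 0"
  proof (rule ccontr)
    assume "\<not> degree ?F > 0"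
    then obtain c where "?F = [:c:]" by (metis degree_eq_zeroE gr0I)
    then have "peval f x = poly (poly c [:x v:]) (x w)" for x
      using nested[of f x] by simp
    with dep uvw show False by metis
  qed
  moreover have "\<not> ?F dvd ?G"
  proof
    assume "?F dvd ?G"
    then obtain Q where "?G = ?F * Q" by (elim dvdE)
    moreover obtain q :: "3 cpoly" where "nested u v q = Q" using nested_surj[OF uvw] by blast
    ultimately have "nested u v g = nested u v (f * q)" by (simp add: nested_mult)
    with nested_inject[OF uvw] ndvd show False by (metis dvdI)
  qed
  ultimately obtain A B c where ABc: "A * ?F + B * ?G = [:c:]" "c \<noteq> 0"
    using coprime_elimination[OF irreducible_nested[OF uvw assms(1)], of "nested u v g"] by blast
  \<comment> \<open>Outside the zeros of \<open>L\<close> the degree of \<open>f\<close> in the main variable does not drop, so \<open>f\<close> has a root.\<close>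
  define L where "L = c * lead_coeff ?F"
  have "L \<noteq> 0" using ABc(2) \<open>degree ?F > 0\<close> by (auto simp: L_def)
  then obtain b a where L: "poly (poly L [:b:]) a \<noteq> 0" by (rule nonzero_value_2)
  define ev where "ev = (\<lambda>C. poly (poly C [:b:]) a)"
  have ev_root: "poly (map_poly ev P) t = ev (poly P [:[:t:]:])" for P t
    by (induction P) (auto simp: map_poly_pCons ev_def)
  have "coeff (map_poly ev ?F) (degree ?F) \<noteq> 0"
    using L by (simp add: coeff_map_poly ev_def L_def)
  then have "degree (map_poly ev ?F) > 0"
    using \<open>degree ?F > 0\<close> le_degree by (metis gr0I leD)
  then obtain t where t: "poly (map_poly ev ?F) t = 0"
    using alg_closed_imp_poly_has_root by blast
  define x where "x = (\<lambda>i. if i = u then t else if i = v then b else a)"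
  have x: "x u = t" "x v = b" "x w = a" using uvw by (auto simp: x_def)
  have "peval f x = 0"
    using t unfolding nested[symmetric] x ev_root by (simp add: ev_def)
  then have "peval g x = 0" by (rule assms(4))
  have "poly (poly (poly (A * ?F + B * ?G) [:[:x u:]:]) [:x v:]) (x w) = 0"
    using \<open>peval f x = 0\<close> \<open>peval g x = 0\<close> by (simp add: nested)
  then have "poly (poly c [:b:]) a = 0"
    by (simp add: ABc(1) x)
  with L show False by (simp add: L_def)
qed

text \<open>
  The quotient of two forms of the same degree is invariant under scaling of the argument, so the
  quotient polynomial is constant on lines through the origin and equal to its value at the origin.
\<close>
lemma irreducible_form_determined_by_zeros:
  fixes f g :: "3 cpoly"
  assumes "irreducible f" "form m f" "form m g" "m > 0" "\<And>x. peval f x = 0 \<Longrightarrow> peval g x = 0"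
  obtains s where "\<And>x. peval g x = s * peval f x"
proof -
  have "f dvd g"
    using assms(5) by (rule irreducible_form_dvd[OF assms(1,2,4)])
  then obtain q where q: "g = f * q" by (elim dvdE)
  define s where "s = peval q (\<lambda>i. 0)"
  have "peval g x = s * peval f x" for x
  proof (cases "peval f x = 0")
    case False
    obtain Q where Q: "\<forall>t. poly Q t = peval q (\<lambda>i. 0 + t * x i)"
      using peval_on_line[of q "\<lambda>i. 0" x] by blast
    have "poly (Q - [:peval q x:]) t = 0" if "t \<noteq> 0" for t
    proof -
      have "t ^ m * peval g x = (t ^ m * peval f x) * poly Q t"
        using peval_scaled_argument[OF assms(3), of t x] peval_scaled_argument[OF assms(2), of t x]
        using Q by (auto simp: q peval_mult)
      with that False show ?thesis by (auto simp: q peval_mult)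
    qed
    then have "UNIV - {0} \<subseteq> {t. poly (Q - [:peval q x:]) t = 0}" by auto
    moreover have "infinite (UNIV - {0 :: complex})"
      by (simp add: infinite_UNIV_char_0)
    ultimately have "Q - [:peval q x:] = 0"
      using poly_roots_finite infinite_super by blast
    then have "poly Q 0 = peval q x" by simp
    then have "peval q x = s" by (simp add: Q s_def)
    then show ?thesis by (simp add: q peval_mult)
  qed (use assms(5) in simp)
  with that show thesis by blast
qed

section \<open>Counting coefficients and equations\<close>

text \<open>Gaussian elimination: the last equation is solved for one of its unknowns.\<close>
lemma homogeneous_system_nontrivial:
  fixes a :: "nat \<Rightarrow> 'e \<Rightarrow> complex"
  assumes "finite E" "q < card E"
  shows "\<exists>g. (\<exists>e\<in>E. g e \<noteq> 0) \<and> (\<forall>j<q. (\<Sum>e\<in>E. a j e * g e) = 0)"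
  using assms
proof (induction q arbitrary: E a)
  case 0
  then have "E \<noteq> {}" by auto
  then show ?case by (intro exI[of _ "\<lambda>_. 1"]) auto
next
  case (Suc q)
  show ?case
  proof (cases "\<forall>e\<in>E. a q e = 0")
    case True
    from Suc.prems Suc.IH[of E a] obtain g where "\<exists>e\<in>E. g e \<noteq> 0" "\<forall>j<q. (\<Sum>e\<in>E. a j e * g e) = 0"
      by auto
    then show ?thesis using True by (intro exI[of _ g]) (auto simp: less_Suc_eq)
  next
    case False
    then obtain e0 where e0: "e0 \<in> E" "a q e0 \<noteq> 0" by blast
    \<comment> \<open>The remaining equations after the unknown \<open>e0\<close> has been eliminated by means of equation \<open>q\<close>.\<close>
    define a' where "a' j e = a j e - a j e0 * a q e / a q e0" for j e
    have "q < card (E - {e0})" using Suc.prems e0 by simp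
    with Suc.prems(1) Suc.IH[of "E - {e0}" a'] obtain g
      where g: "\<exists>e\<in>E - {e0}. g e \<noteq> 0" "\<forall>j<q. (\<Sum>e\<in>E - {e0}. a' j e * g e) = 0"
      by auto
    define S where "S = (\<Sum>e\<in>E - {e0}. a q e * g e)"
    define g' where "g' = g(e0 := - S / a q e0)"
    have sum_g': "(\<Sum>e\<in>E. a j e * g' e) = a j e0 * (- S / a q e0) + (\<Sum>e\<in>E - {e0}. a j e * g e)" for j
      using Suc.prems(1) e0(1) by (simp add: sum.remove g'_def)
    have "(\<Sum>e\<in>E. a j e * g' e) = 0" if "j < Suc q" for j
    proof (cases "j = q")
      case True
      then show ?thesis using sum_g' e0 by (simp add: S_def)
    next
      case False
      with that g(2) have "0 = (\<Sum>e\<in>E - {e0}. a' j e * g e)" by simp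
      also have "\<dots> = (\<Sum>e\<in>E - {e0}. a j e * g e - (a j e0 / a q e0) * (a q e * g e))"
        by (intro sum.cong) (auto simp: a'_def algebra_simps)
      also have "\<dots> = (\<Sum>e\<in>E - {e0}. a j e * g e) - (a j e0 / a q e0) * S"
        by (simp add: sum_subtractf S_def sum_distrib_left)
      finally show ?thesis by (simp add: sum_g')
    qed
    moreover have "\<exists>e\<in>E. g' e \<noteq> 0" using g(1) by (auto simp: g'_def)
    ultimately show ?thesis by blast
  qed
qed

text \<open>
  With an enumeration of the variables, exponent vectors become lists of natural numbers with given
  length and sum, whose number is known.
\<close>
lemma exponents_lists:
  assumes "set vs = (UNIV :: 'v::finite set)" "distinct vs"
  shows "bij_betw (\<lambda>e. map (Poly_Mapping.lookup e) vs) (exponents n)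
    {l. length l = CARD('v) \<and> sum_list l = n}"
proof (rule bij_betw_imageI)
  have len: "length vs = CARD('v)"
    using assms distinct_card by metis
  have sum: "sum_list (map (Poly_Mapping.lookup e) vs)
      = (\<Sum>i\<in>Poly_Mapping.keys e. Poly_Mapping.lookup e i)" for e :: "'v \<Rightarrow>\<^sub>0 nat"
    using assms lookup_sum_keys_superset[of UNIV e] by (simp add: sum_list_distinct_conv_sum_set)
  show "inj_on (\<lambda>e. map (Poly_Mapping.lookup e) vs) (exponents n)"
    by (rule inj_onI) (auto intro!: poly_mapping_eqI simp: assms(1))
  have "l \<in> (\<lambda>e. map (Poly_Mapping.lookup e) vs) ` exponents n"
    if l: "length l = CARD('v)" "sum_list l = n" for l
  proof -
    define e where "e = Abs_poly_mapping (\<lambda>v. the (map_of (zip vs l) v))"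
    have lookup: "Poly_Mapping.lookup e v = the (map_of (zip vs l) v)" for v
      by (simp add: e_def)
    have l_eq: "l = map (Poly_Mapping.lookup e) vs"
    proof (rule nth_equalityI)
      fix i assume "i < length l"
      then have "map_of (zip vs l) (vs ! i) = Some (l ! i)"
        using l len assms(2) by (intro map_of_is_SomeI) (auto simp: in_set_zip)
      then show "l ! i = map (Poly_Mapping.lookup e) vs ! i"
        using \<open>i < length l\<close> l len by (simp add: lookup)
    qed (use l len in simp)
    moreover have "e \<in> exponents n"
      using sum[of e] l(2) l_eq by (simp add: exponents_def)
    ultimately show ?thesis by blast
  qed
  then show "(\<lambda>e. map (Poly_Mapping.lookup e) vs) ` exponents n =
      {l. length l = CARD('v) \<and> sum_list l = n}"
    using len sum by (auto simp: exponents_def)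
qed

lemma card_exponents: "card (exponents n :: ('v::finite \<Rightarrow>\<^sub>0 nat) set) = (n + CARD('v) - 1) choose n"
proof -
  obtain vs where vs: "set vs = (UNIV :: 'v set)" "distinct vs"
    using finite_distinct_list[of "UNIV :: 'v set"] by auto
  from bij_betw_same_card[OF exponents_lists[OF vs]] card_length_sum_list show ?thesis by simp
qed

lemma finite_exponents: "finite (exponents n :: ('v::finite \<Rightarrow>\<^sub>0 nat) set)"
proof (rule card_ge_0_finite)
  have "n \<le> n + CARD('v) - 1" using zero_less_card_finite[where 'a='v] by linarith
  then show "card (exponents n :: ('v \<Rightarrow>\<^sub>0 nat) set) > 0"
    by (simp add: card_exponents)
qed

text \<open>
  Both binomial coefficients minus one are divisible by \<open>m\<close> as polynomials in \<open>m\<close>: the number of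
  equations of a view is \<open>m (m + 3) / 2\<close>, and the number of unknowns minus one is
  \<open>m (m\<^sup>2 + 6 m + 11) / 6\<close>. For \<open>m = 0\<close> both numbers vanish and the equivalence fails.
\<close>
lemma view_count_iff:
  assumes "m > 0"
  shows "k * ((m + 2 choose m) - 1) \<ge> (m + 3 choose m) - 1 \<longleftrightarrow>
    real k \<ge> (real m ^ 2 + 6 * real m + 11) / (3 * (real m + 3))"
proof -
  have 2: "2 * (m + 2 choose m) = (m + 2) * (m + 1)"
  proof -
    have "(m + 2 choose m) = (Suc (Suc m) choose 2)"
      using binomial_symmetric[of m "m + 2"] by simp
    moreover have "2 * (Suc (Suc m) choose 2) = (m + 2) * (m + 1)"
      using Suc_times_binomial_eq[of "Suc m" 1] by (simp add: numeral_2_eq_2)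
    ultimately show ?thesis by simp
  qed
  have 3: "6 * (m + 3 choose m) = (m + 3) * (m + 2) * (m + 1)"
  proof -
    have e1: "(m + 3 choose m) = (Suc (m + 2) choose Suc 2)"
      using binomial_symmetric[of m "m + 3"] by (simp add: numeral_3_eq_3)
    have e2: "(m + 2 choose m) = (m + 2 choose 2)"
      using binomial_symmetric[of m "m + 2"] by simp
    have "3 * (Suc (m + 2) choose Suc 2) = (m + 3) * (m + 2 choose 2)"
      using Suc_times_binomial_eq[of "m + 2" 2] by (simp add: algebra_simps)
    then have "6 * (m + 3 choose m) = (m + 3) * (2 * (m + 2 choose m))"
      unfolding e1 e2 by simp
    then show ?thesis by (simp only: 2 mult.assoc)
  qed
  have pos: "(m + 2 choose m) \<ge> 1" "(m + 3 choose m) \<ge> 1"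
    by (simp_all add: Suc_leI)
  have r2: "real ((m + 2 choose m) - 1) = real m * (real m + 3) / 2"
    using pos(1) arg_cong[OF 2, of real] by (simp add: of_nat_diff field_simps)
  have r3: "real ((m + 3 choose m) - 1) = real m * (real m ^ 2 + 6 * real m + 11) / 6"
    using pos(2) arg_cong[OF 3, of real] by (simp add: of_nat_diff field_simps power2_eq_square)
  have "k * ((m + 2 choose m) - 1) \<ge> (m + 3 choose m) - 1 \<longleftrightarrow>
    real ((m + 3 choose m) - 1) \<le> real k * real ((m + 2 choose m) - 1)"
    by (simp flip: of_nat_mult)
  also have "\<dots> \<longleftrightarrow> real m * (real m ^ 2 + 6 * real m + 11) \<le> real m * (real k * (3 * (real m + 3)))"
  proof -
    have "real k * (real m * (real m + 3) / 2) = real m * (real k * (3 * (real m + 3))) / 6"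
      by simp
    then show ?thesis unfolding r2 r3 by (simp only: divide_le_cancel) simp
  qed
  also have "\<dots> \<longleftrightarrow> real m ^ 2 + 6 * real m + 11 \<le> real k * (3 * (real m + 3))"
    using assms by (subst mult_le_cancel_left_pos) auto
  also have "\<dots> \<longleftrightarrow> real k \<ge> (real m ^ 2 + 6 * real m + 11) / (3 * (real m + 3))"
    by (subst pos_divide_le_eq) auto
  finally show ?thesis .
qed

section \<open>Tangent planes under projection\<close>

lemma \<mu>_component: "\<mu> M l $ i = (\<Sum>j\<in>UNIV. M $ j $ i * l $ j)"
  by (simp add: \<mu>_def matrix_vector_mult_def transpose_def)

lemma pairing_\<mu>: "pairing (\<mu> M l) x = pairing l (M *v x)"
proof -
  have "pairing (\<mu> M l) x = (\<Sum>i\<in>UNIV. \<Sum>j\<in>UNIV. l $ j * (M $ j $ i * x $ i))"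
    by (simp add: pairing_def \<mu>_component sum_distrib_right sum_distrib_left mult_ac)
  also have "\<dots> = pairing l (M *v x)"
    by (subst sum.swap) (simp add: pairing_def matrix_vector_mult_def sum_distrib_left)
  finally show ?thesis .
qed

lemma \<mu>_rows: "\<mu> M l = (\<Sum>j\<in>UNIV. l $ j *s row j M)"
  by (simp add: vec_eq_iff \<mu>_component row_def mult.commute)

lemma subspace_pairing_right: "vec.subspace {v. pairing h v = 0}"
  by (rule vec.subspaceI) (simp_all add: pairing_def distrib_left sum.distrib mult_ac flip: sum_distrib_left)

lemma subspace_pairing_left: "vec.subspace {h. pairing h v = 0}"
  by (rule vec.subspaceI) (simp_all add: pairing_def distrib_right sum.distrib mult.assoc flip: sum_distrib_left)

text \<open>A relation between the rows of \<open>M\<close> would put all of them into the span of two rows.\<close>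
lemma \<mu>_eq_0:
  assumes "rank M = 3" "\<mu> M l = 0"
  shows "l = 0"
proof (rule ccontr)
  assume "l \<noteq> 0"
  then obtain p where p: "l $ p \<noteq> 0" by (auto simp: vec_eq_iff)
  let ?W = "(\<lambda>j. row j M) ` (UNIV - {p})"
  have "l $ p *s row p M = - (\<Sum>j\<in>UNIV - {p}. l $ j *s row j M)"
    using assms(2) by (simp add: \<mu>_rows sum.remove[of UNIV p] eq_neg_iff_add_eq_0)
  also have "\<dots> \<in> vec.span ?W"
    by (intro vec.span_neg vec.span_sum vec.span_scale vec.span_base) auto
  finally have "(1 / l $ p) *s (l $ p *s row p M) \<in> vec.span ?W"
    by (rule vec.span_scale)
  then have "row p M \<in> vec.span ?W" using p by simp
  then have "rows M \<subseteq> vec.span ?W"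
    by (auto simp: rows_def intro: vec.span_base)
  then have "vec.dim (rows M) \<le> card ?W"
    by (rule vec.dim_le_card) simp
  also have "\<dots> \<le> 2"
    using card_image_le[of "UNIV - {p}" "\<lambda>j. row j M"] by (simp add: card_Diff_singleton)
  finally show False using assms(1) by (simp add: row_rank_def_gen)
qed

text \<open>
  The range of \<open>\<mu> M\<close> is the row space of \<open>M\<close>, of dimension three; it is contained in the space of
  all planes through the center, which is a proper subspace of a space of dimension four.
\<close>
lemma plane_through_center:
  assumes "camera_center M c" "pairing h c = 0"
  obtains l where "h = \<mu> M l"
proof -
  let ?P = "{h. pairing h c = 0}"
  have M: "rank M = 3" "c \<noteq> 0" "M *v c = 0" using assms(1) by (auto simp: camera_center_def)
  obtain p where p: "c $ p \<noteq> 0" using M(2) by (auto simp: vec_eq_iff)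
  have "pairing (axis p 1) c = c $ p"
    by (simp add: pairing_def axis_def if_distrib[of "\<lambda>x. x * _"] cong: if_cong)
  then have "axis p 1 \<notin> ?P" using p by simp
  then have "vec.span ?P \<noteq> UNIV"
    using vec.span_eq_iff[of ?P] subspace_pairing_left by blast
  then have "vec.dim ?P \<noteq> 4"
    using vec.dim_eq_full[of ?P] by (simp add: vec.dimension_def card_cart_basis)
  moreover have "vec.dim ?P \<le> 4"
    using vec.dim_subset_UNIV[of ?P] by (simp add: vec.dimension_def card_cart_basis)
  ultimately have dim: "vec.dim ?P \<le> vec.dim (vec.span (rows M))"
    using M(1) by (simp add: row_rank_def_gen)
  have row_\<mu>: "row j M = \<mu> M (axis j 1)" for j
    by (simp add: vec_eq_iff \<mu>_component row_def axis_def if_distrib cong: if_cong)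
  have "rows M \<subseteq> ?P"
    by (auto simp: rows_def row_\<mu> pairing_\<mu> M(3)) (simp add: pairing_def)
  then have "vec.span (rows M) \<subseteq> ?P"
    by (rule vec.span_minimal[OF _ subspace_pairing_left])
  then have "vec.span (rows M) = ?P"
    using vec.subspace_dim_equal[OF vec.subspace_span subspace_pairing_left _ dim] by blast
  moreover have "vec.span (rows M) \<subseteq> range (\<mu> M)"
  proof (rule vec.span_minimal)
    show "rows M \<subseteq> range (\<mu> M)" by (auto simp: rows_def row_\<mu>)
    show "vec.subspace (range (\<mu> M))"
    proof (rule vec.subspaceI)
      show "0 \<in> range (\<mu> M)" by (rule range_eqI[of _ _ 0]) (simp add: \<mu>_def)
      fix x y assume "x \<in> range (\<mu> M)" "y \<in> range (\<mu> M)"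
      then obtain k l where kl: "x = \<mu> M k" "y = \<mu> M l" by blast
      have "x + y = \<mu> M (k + l)"
        unfolding kl \<mu>_def by (rule matrix_vector_right_distrib[symmetric])
      then show "x + y \<in> range (\<mu> M)" by blast
    next
      fix x a assume "x \<in> range (\<mu> M)"
      then obtain k where k: "x = \<mu> M k" by blast
      have "a *s x = \<mu> M (a *s k)"
        unfolding k \<mu>_def by (rule vector_scalar_commute[symmetric])
      then show "a *s x \<in> range (\<mu> M)" by blast
    qed
  qed
  ultimately have "h \<in> range (\<mu> M)" using assms(2) by blast
  with that show thesis by blast
qed

lemma form_pullback:
  fixes A :: "complex^'n^'m"
  assumes "form n p"
  obtains q where "form n q" "\<forall>x. peval q (($) x) = peval p (($) (A *v x))"
proof -
  have "form_fun n (\<lambda>y. peval p (\<lambda>i. \<Sum>j\<in>UNIV. A $ i $ j * y j))"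
    using assms by (rule form_fun_compose) (intro form_fun_sum form_fun_scale form_fun_var)
  then obtain q where q: "form n q" "\<forall>y. peval q y = peval p (\<lambda>i. \<Sum>j\<in>UNIV. A $ i $ j * y j)"
    by (auto simp: form_fun_def)
  have "(\<lambda>i. \<Sum>j\<in>UNIV. A $ i $ j * x $ j) = ($) (A *v x)" for x
    by (simp add: matrix_vector_mult_def fun_eq_iff)
  with q show thesis by (intro that[of q]) simp_all
qed

lemma subset_zariski_closure: "0 \<notin> S \<Longrightarrow> S \<subseteq> zariski_closure S"
  by (auto simp: zariski_closure_def zero_locus_def vanishing_forms_def)

text \<open>
  The pullback along \<open>M\<close> of a form that vanishes on the image of \<open>X\<close> vanishes on \<open>X\<close>, and its
  restriction to a line is the restriction of the original form to the image of that line.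
\<close>
lemma tangent_space_image:
  assumes "v \<in> tangent_space X x"
  shows "M *v v \<in> tangent_space ((*v) M ` X) (M *v x)"
  unfolding tangent_space_def
proof (rule CollectI, rule ballI)
  fix f assume f: "f \<in> vanishing_forms ((*v) M ` X)"
  then obtain n where "form n f" by (auto simp: vanishing_forms_def)
  then obtain q where q: "form n q" "\<forall>x. peval q (($) x) = peval f (($) (M *v x))"
    by (rule form_pullback[where A = M])
  have "q \<in> vanishing_forms X"
    using f q by (auto simp: vanishing_forms_def)
  with assms have "deriv (\<lambda>t. peval q (($) (x + t *s v))) 0 = 0"
    by (auto simp: tangent_space_def)
  moreover have "M *v (x + t *s v) = M *v x + t *s (M *v v)" for t
    by (simp add: matrix_vector_right_distrib vector_scalar_commute)
  ultimately show "deriv (\<lambda>t. peval f (($) (M *v x + t *s (M *v v)))) 0 = 0"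
    by (simp add: q(2))
qed

lemma tangent_plane_in_dual:
  assumes "smooth_point X x" "h \<noteq> 0" "\<And>v. v \<in> tangent_space X x \<Longrightarrow> pairing h v = 0"
  shows "h \<in> dual_variety X"
proof -
  let ?S = "{h. h \<noteq> 0 \<and> (\<exists>x. smooth_point X x \<and> (\<forall>v\<in>tangent_space X x. pairing h v = 0))}"
  have "h \<in> ?S" using assms by blast
  moreover have "?S \<subseteq> zariski_closure ?S" by (rule subset_zariski_closure) simp
  ultimately show ?thesis unfolding dual_variety_def by blast
qed

text \<open>
  The pullback of \<open>\<Upsilon>\<close> along \<open>\<mu> M\<close> vanishes at all tangent lines of the image curve, hence on their
  Zariski closure, which is the zero locus of the irreducible form \<open>\<phi>\<close> of the same degree.
\<close>
lemma dual_view_equation: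
  assumes "\<And>x. x \<in> X \<Longrightarrow> smooth_point X x" "dual_variety X \<subseteq> zero_locus {\<Upsilon>}"
    and "form m \<Upsilon>" "m > 0" "dual_view m X M \<phi>"
  shows "\<exists>s. \<forall>l. peval \<Upsilon> (($) (\<mu> M l)) = s * peval \<phi> (($) l)"
proof -
  have M: "rank M = 3" and \<phi>: "irreducible \<phi>" "form m \<phi>" "dual_variety ((*v) M ` X) = zero_locus {\<phi>}"
    using assms(5) by (auto simp: dual_view_def)
  obtain q where q: "form m q" "\<forall>l. peval q (($) l) = peval \<Upsilon> (($) (\<mu> M l))"
    using form_pullback[OF assms(3), where A = "transpose M"] unfolding \<mu>_def by blast
  let ?S = "{h. h \<noteq> 0 \<and> (\<exists>y. smooth_point ((*v) M ` X) y \<and>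
      (\<forall>v\<in>tangent_space ((*v) M ` X) y. pairing h v = 0))}"
  have vanish: "q \<in> vanishing_forms ?S"
    unfolding vanishing_forms_def
  proof (intro CollectI conjI ballI exI[of _ m] q(1))
    fix h assume "h \<in> ?S"
    then obtain y where h: "h \<noteq> 0" "smooth_point ((*v) M ` X) y"
      "\<forall>v\<in>tangent_space ((*v) M ` X) y. pairing h v = 0" by blast
    then obtain x where x: "x \<in> X" "y = M *v x" by (auto simp: smooth_point_def)
    have "\<mu> M h \<in> dual_variety X"
    proof (rule tangent_plane_in_dual[OF assms(1)[OF x(1)]])
      show "\<mu> M h \<noteq> 0" using \<mu>_eq_0[OF M] h(1) by blast
      show "pairing (\<mu> M h) v = 0" if "v \<in> tangent_space X x" for v
        using tangent_space_image[OF that, of M] h(3) by (simp add: pairing_\<mu> x(2))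
    qed
    with assms(2) show "peval q (($) h) = 0"
      by (auto simp: q(2) zero_locus_def)
  qed
  have "peval q x = 0" if "peval \<phi> x = 0" for x
  proof -
    define l :: "complex^3" where "l = (\<chi> i. x i)"
    have x: "x = ($) l" by (simp add: l_def fun_eq_iff)
    show ?thesis
    proof (cases "l = 0")
      case True
      then have "x = (\<lambda>i. 0)" by (simp add: x fun_eq_iff)
      then show ?thesis using peval_zero_vector[OF q(1) assms(4)] by simp
    next
      case False
      with that have "l \<in> zero_locus {\<phi>}" by (simp add: zero_locus_def x)
      then have "l \<in> zero_locus (vanishing_forms ?S)"
        by (simp only: \<phi>(3)[symmetric] dual_variety_def zariski_closure_def)
      with vanish show ?thesis by (auto simp: zero_locus_def x)
    qed
  qed
  then obtain s where "\<And>x. peval q x = s * peval \<phi> x"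
    using irreducible_form_determined_by_zeros[OF \<phi>(1,2) q(1) assms(4)] by blast
  then show ?thesis by (intro exI[of _ s]) (use q(2) in simp)
qed

lemma variety_chain_mono:
  assumes "variety_chain V n" "k \<le> n"
  shows "variety_chain V k"
proof -
  from assms(1) obtain C where "\<forall>i\<le>n. irreducible_variety (C i) \<and> C i \<subseteq> V" "\<forall>i<n. C i \<subset> C (Suc i)"
    unfolding variety_chain_def by blast
  with assms(2) show ?thesis
    unfolding variety_chain_def by (intro exI[of _ C]) auto
qed

lemma has_proj_dim_unique: "has_proj_dim V n \<Longrightarrow> has_proj_dim V k \<Longrightarrow> n = k"
  unfolding has_proj_dim_def using variety_chain_mono not_less_eq_eq
  by (metis le_antisym)

lemma normal_vector_exists:
  fixes S :: "(complex^'n) set"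
  assumes "vec.dim S < CARD('n)"
  obtains h where "h \<noteq> 0" "\<And>v. v \<in> S \<Longrightarrow> pairing h v = 0"
proof -
  obtain B where B: "B \<subseteq> S" "vec.independent B" "S \<subseteq> vec.span B" "card B = vec.dim S"
    by (rule vec.basis_exists)
  have "finite B" using B(2) by (rule vec.finiteI_independent)
  then obtain b where b: "bij_betw b {0..<card B} B" using ex_bij_betw_nat_finite by blast
  obtain g where g: "\<exists>e. g e \<noteq> 0" "\<forall>j<card B. (\<Sum>e\<in>UNIV. b j $ e * g e) = 0"
    using homogeneous_system_nontrivial[of "UNIV :: 'n set" "card B" "\<lambda>j e. b j $ e"] assms B(4) by auto
  define h where "h = (\<chi> e. g e)"
  have "pairing h v = 0" if v: "v \<in> B" for v
  proof -
    from v b obtain j where "j \<in> {0..<card B}" "v = b j" unfolding bij_betw_def by blast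
    with g(2) show ?thesis by (simp add: pairing_def h_def mult.commute)
  qed
  then have "vec.span B \<subseteq> {v. pairing h v = 0}"
    by (intro vec.span_minimal subspace_pairing_right) auto
  moreover have "h \<noteq> 0" using g(1) by (auto simp: h_def vec_eq_iff)
  ultimately show thesis using that B(3) by blast
qed

text \<open>
  A nonzero form of degree zero has no zeros, but the dual variety of a curve is nonempty: the
  tangent space of a curve at a smooth point has dimension two and so lies in a plane.
\<close>
lemma dual_degree_positive:
  assumes "smooth_irreducible_curve X" "form m \<Upsilon>" "\<Upsilon> \<noteq> 0" "dual_variety X \<subseteq> zero_locus {\<Upsilon>}"
  shows "m > 0"
proof (rule ccontr)
  assume "\<not> m > 0"
  then have m: "m = 0" by simp
  have "peval \<Upsilon> x = Poly_Mapping.lookup \<Upsilon> 0" for x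
  proof -
    have "Poly_Mapping.keys \<Upsilon> \<subseteq> {0}"
      using assms(2) by (auto simp: m form_def exponents_def in_keys_iff poly_mapping_eq_iff fun_eq_iff)
    moreover have "Poly_Mapping.keys \<Upsilon> \<noteq> {}"
      using assms(3) by (auto simp: poly_mapping_eq_iff fun_eq_iff in_keys_iff)
    ultimately have "Poly_Mapping.keys \<Upsilon> = {0}" by blast
    then show ?thesis by (simp add: peval_monomials)
  qed
  moreover have "Poly_Mapping.lookup \<Upsilon> 0 \<noteq> 0"
    using calculation assms(3) nonzero_value by metis
  ultimately have "zero_locus {\<Upsilon>} = {}" by (simp add: zero_locus_def)
  obtain x where x: "x \<in> X" and dim: "has_proj_dim X 1" and smooth: "smooth_point X x"
    using assms(1) by (auto simp: smooth_irreducible_curve_def irreducible_variety_def)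
  from smooth dim have "vec.dim (tangent_space X x) = 2"
    using has_proj_dim_unique by (fastforce simp: smooth_point_def)
  then obtain h where "h \<noteq> 0" "\<And>v. v \<in> tangent_space X x \<Longrightarrow> pairing h v = 0"
    using normal_vector_exists[of "tangent_space X x"] by auto
  then have "h \<in> dual_variety X" by (rule tangent_plane_in_dual[OF smooth])
  with assms(4) \<open>zero_locus {\<Upsilon>} = {}\<close> show False by blast
qed

section \<open>The linear equations of the views\<close>

lemma linear_system_intersection:
  assumes "\<And>i. i < k \<Longrightarrow> linear_system m q (S i)"
  shows "linear_system m (k * q) {G. form m G \<and> (\<forall>i<k. G \<in> S i)}"
proof -
  have "\<forall>i\<in>{..<k}. \<exists>a. S i = {G. form m G \<and>
      (\<forall>j<q. (\<Sum>e\<in>exponents m. a j e * Poly_Mapping.lookup G e) = 0)}"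
    using assms by (simp add: linear_system_def)
  from bchoice[OF this] obtain a where a: "\<And>i. i < k \<Longrightarrow> S i = {G. form m G \<and>
      (\<forall>j<q. (\<Sum>e\<in>exponents m. a i j e * Poly_Mapping.lookup G e) = 0)}"
    by auto
  \<comment> \<open>Equation \<open>j\<close> of system \<open>i\<close> becomes equation \<open>i * q + j\<close> of the joint system.\<close>
  have reindex: "(\<forall>i<k. \<forall>j<q. P i j) \<longleftrightarrow> (\<forall>n<k * q. P (n div q) (n mod q))" for P :: "nat \<Rightarrow> nat \<Rightarrow> bool"
  proof safe
    fix n assume "\<forall>i<k. \<forall>j<q. P i j" "n < k * q"
    moreover from this(2) have "n div q < k" "n mod q < q"
      by (auto simp: less_mult_imp_div_less intro!: mod_less_divisor) (metis gr0I mult_0_right not_less0)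
    ultimately show "P (n div q) (n mod q)" by blast
  next
    fix i j assume *: "\<forall>n<k * q. P (n div q) (n mod q)" "i < k" "j < q"
    have "i * q + j < Suc i * q" using \<open>j < q\<close> by simp
    also have "\<dots> \<le> k * q" using \<open>i < k\<close> by (intro mult_right_mono) auto
    finally have "P ((i * q + j) div q) ((i * q + j) mod q)" using *(1) by blast
    with \<open>j < q\<close> show "P i j" by simp
  qed
  have "{G. form m G \<and> (\<forall>i<k. G \<in> S i)} = {G. form m G \<and>
      (\<forall>n<k * q. (\<Sum>e\<in>exponents m. a (n div q) (n mod q) e * Poly_Mapping.lookup G e) = 0)}"
    (is "_ = {G. form m G \<and> (\<forall>n<k * q. ?P G (n div q) (n mod q))}")
  proof (rule Collect_cong)
    fix G
    show "(form m G \<and> (\<forall>i<k. G \<in> S i)) \<longleftrightarrow> (form m G \<and> (\<forall>n<k * q. ?P G (n div q) (n mod q)))"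
      unfolding reindex[of "?P G", symmetric] by (auto simp: a)
  qed
  then show ?thesis
    unfolding linear_system_def by (intro exI[of _ "\<lambda>n. a (n div q) (n mod q)"])
qed

text \<open>
  The coefficients of \<open>G \<circ> \<mu> M\<close> are linear in those of \<open>G\<close>. If \<open>f0\<close> is a monomial that occurs in
  \<open>\<phi>\<close>, the scalar is determined by the coefficients of \<open>f0\<close>, and there remains one equation for
  each other monomial of degree \<open>m\<close>.
\<close>
lemma view_equations_linear:
  fixes \<phi> :: "3 cpoly"
  assumes "\<phi> \<noteq> 0" "form m \<phi>"
  shows "linear_system m ((m + 2 choose m) - 1)
    {G. form m G \<and> (\<exists>s. \<forall>l. peval G (($) (\<mu> M l)) = s * peval \<phi> (($) l))}"
proof -
  let ?E = "exponents m :: (4 \<Rightarrow>\<^sub>0 nat) set" and ?E3 = "exponents m :: (3 \<Rightarrow>\<^sub>0 nat) set"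
  have "\<exists>q. form m q \<and> (\<forall>l. peval q (($) l) = monomial_at (($) (\<mu> M l)) e)" if "e \<in> ?E" for e
  proof -
    have "form m (Poly_Mapping.single e 1)" using that by (simp add: form_def)
    then obtain q where "form m q" "\<forall>l. peval q (($) l) = peval (Poly_Mapping.single e 1) (($) (\<mu> M l))"
      unfolding \<mu>_def by (rule form_pullback)
    then show ?thesis by (auto simp: peval_single)
  qed
  then obtain r where r: "\<forall>e\<in>?E. form m (r e) \<and> (\<forall>l. peval (r e) (($) l) = monomial_at (($) (\<mu> M l)) e)"
    using bchoice[of ?E "\<lambda>e q. form m q \<and> (\<forall>l. peval q (($) l) = monomial_at (($) (\<mu> M l)) e)"] by blast
  define pb where "pb G = (\<Sum>e\<in>?E. Poly_Mapping.single 0 (Poly_Mapping.lookup G e) * r e)" for G :: "4 cpoly"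
  have pb_form: "form m (pb G)" for G
    unfolding pb_def using r by (intro form_sum form_scale) auto
  have pb_eval: "peval (pb G) (($) l) = peval G (($) (\<mu> M l))" if "form m G" for G l
  proof -
    have "peval (pb G) (($) l) = (\<Sum>e\<in>?E. Poly_Mapping.lookup G e * monomial_at (($) (\<mu> M l)) e)"
      using r by (simp add: pb_def peval_sum peval_scale)
    also have "\<dots> = peval G (($) (\<mu> M l))"
      unfolding peval_monomials using that
      by (intro sum.mono_neutral_right finite_exponents) (auto simp: form_def in_keys_iff)
    finally show ?thesis .
  qed
  have pb_lookup: "Poly_Mapping.lookup (pb G) f = (\<Sum>e\<in>?E. Poly_Mapping.lookup G e * Poly_Mapping.lookup (r e) f)" for G f
    by (simp add: pb_def lookup_sum lookup_scale)
  obtain f0 where "Poly_Mapping.lookup \<phi> f0 \<noteq> 0"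
    using assms(1) by (auto simp: poly_mapping_eq_iff fun_eq_iff)
  then have f0: "f0 \<in> ?E3" "Poly_Mapping.lookup \<phi> f0 \<noteq> 0"
    using assms(2) by (auto simp: form_def in_keys_iff)
  \<comment> \<open>Equation \<open>f\<close> says that the coefficients of \<open>f0\<close> and \<open>f\<close> in \<open>pb G\<close> and in \<open>\<phi>\<close> have a vanishing
     two-by-two determinant.\<close>
  define A where "A f e = Poly_Mapping.lookup (r e) f * Poly_Mapping.lookup \<phi> f0
      - Poly_Mapping.lookup (r e) f0 * Poly_Mapping.lookup \<phi> f" for f e
  have A: "(\<Sum>e\<in>?E. A f e * Poly_Mapping.lookup G e)
      = Poly_Mapping.lookup (pb G) f * Poly_Mapping.lookup \<phi> f0
        - Poly_Mapping.lookup (pb G) f0 * Poly_Mapping.lookup \<phi> f" for f G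
    by (simp add: A_def pb_lookup sum_distrib_left sum_subtractf right_diff_distrib mult_ac)
  have equiv: "(\<exists>s. \<forall>l. peval G (($) (\<mu> M l)) = s * peval \<phi> (($) l)) \<longleftrightarrow>
      (\<forall>f\<in>?E3 - {f0}. (\<Sum>e\<in>?E. A f e * Poly_Mapping.lookup G e) = 0)" if G: "form m G" for G
  proof
    assume "\<exists>s. \<forall>l. peval G (($) (\<mu> M l)) = s * peval \<phi> (($) l)"
    then obtain s where s: "\<forall>l. peval G (($) (\<mu> M l)) = s * peval \<phi> (($) l)" by blast
    have "pb G = Poly_Mapping.single 0 s * \<phi>"
    proof (rule peval_inject)
      fix x :: "3 \<Rightarrow> complex"
      have x: "x = ($) (\<chi> i. x i)" by (simp add: fun_eq_iff)
      show "peval (pb G) x = peval (Poly_Mapping.single 0 s * \<phi>) x"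
        by (subst (1 2) x) (simp only: pb_eval[OF G] s peval_scale)
    qed
    then show "\<forall>f\<in>?E3 - {f0}. (\<Sum>e\<in>?E. A f e * Poly_Mapping.lookup G e) = 0"
      by (simp add: A lookup_scale)
  next
    assume *: "\<forall>f\<in>?E3 - {f0}. (\<Sum>e\<in>?E. A f e * Poly_Mapping.lookup G e) = 0"
    define s where "s = Poly_Mapping.lookup (pb G) f0 / Poly_Mapping.lookup \<phi> f0"
    have "pb G = Poly_Mapping.single 0 s * \<phi>"
    proof (rule poly_mapping_eqI)
      fix f
      consider "f = f0" | "f \<in> ?E3 - {f0}" | "f \<notin> ?E3" by blast
      then show "Poly_Mapping.lookup (pb G) f = Poly_Mapping.lookup (Poly_Mapping.single 0 s * \<phi>) f"
      proof cases
        case 1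
        then show ?thesis using f0(2) by (simp add: lookup_scale s_def)
      next
        case 2
        with * have "Poly_Mapping.lookup (pb G) f * Poly_Mapping.lookup \<phi> f0
            = Poly_Mapping.lookup (pb G) f0 * Poly_Mapping.lookup \<phi> f" by (simp add: A)
        then show ?thesis
          unfolding lookup_scale s_def using f0(2) by (simp add: field_simps)
      next
        case 3
        with pb_form[of G] assms(2) have "f \<notin> Poly_Mapping.keys (pb G)" "f \<notin> Poly_Mapping.keys \<phi>"
          by (auto simp: form_def)
        then show ?thesis by (simp add: lookup_scale in_keys_iff)
      qed
    qed
    then show "\<exists>s. \<forall>l. peval G (($) (\<mu> M l)) = s * peval \<phi> (($) l)"
      by (intro exI[of _ s] allI) (simp add: peval_scale flip: pb_eval[OF G])
  qed
  have "card (?E3 - {f0}) = (m + 2 choose m) - 1"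
    using f0(1) finite_exponents[of m] card_exponents[where 'v = 3, of m] by simp
  then obtain b where b: "bij_betw b {0..<(m + 2 choose m) - 1} (?E3 - {f0})"
    using ex_bij_betw_nat_finite[of "?E3 - {f0}"] finite_exponents[of m] by auto
  then have "b ` {0..<(m + 2 choose m) - 1} = ?E3 - {f0}" by (simp add: bij_betw_def)
  from this[symmetric] have "(\<forall>f\<in>?E3 - {f0}. P f) \<longleftrightarrow> (\<forall>j<(m + 2 choose m) - 1. P (b j))" for P
    by (simp only: ball_simps atLeast0LessThan lessThan_iff Ball_def) auto
  with equiv show ?thesis
    unfolding linear_system_def by (intro exI[of _ "\<lambda>j. A (b j)"]) auto
qed

text \<open>
  If there were fewer equations, one could add the equation that the coefficient of a monomial of
  \<open>\<Upsilon>\<close> is zero. This excludes all nonzero multiples of \<open>\<Upsilon>\<close>, yet the larger system still has a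
  nonzero solution.
\<close>
lemma unique_solution_needs_equations:
  fixes \<Upsilon> :: "('v::finite) cpoly"
  assumes "linear_system m q S" "S = range (\<lambda>c. Poly_Mapping.single 0 c * \<Upsilon>)" "\<Upsilon> \<noteq> 0"
  shows "q \<ge> card (exponents m :: ('v \<Rightarrow>\<^sub>0 nat) set) - 1"
proof (rule ccontr)
  let ?E = "exponents m :: ('v \<Rightarrow>\<^sub>0 nat) set"
  assume "\<not> q \<ge> card ?E - 1"
  then have q: "Suc q < card ?E" by simp
  obtain a where a: "S = {G. form m G \<and> (\<forall>j<q. (\<Sum>e\<in>?E. a j e * Poly_Mapping.lookup G e) = 0)}"
    using assms(1) unfolding linear_system_def by blast
  have "Poly_Mapping.single 0 1 * \<Upsilon> \<in> S" unfolding assms(2) by (rule rangeI)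
  then have "\<Upsilon> \<in> S" by simp
  then have "form m \<Upsilon>" by (simp add: a)
  obtain e0 where e0: "Poly_Mapping.lookup \<Upsilon> e0 \<noteq> 0"
    using assms(3) by (auto simp: poly_mapping_eq_iff fun_eq_iff)
  then have "e0 \<in> ?E" using \<open>form m \<Upsilon>\<close> by (auto simp: form_def in_keys_iff)
  define a' where "a' j e = (if j < q then a j e else if e = e0 then 1 else 0)" for j e
  obtain g where g: "\<exists>e\<in>?E. g e \<noteq> 0" "\<forall>j<Suc q. (\<Sum>e\<in>?E. a' j e * g e) = 0"
    using homogeneous_system_nontrivial[OF finite_exponents q, of a'] by blast
  define G where "G = Abs_poly_mapping (\<lambda>e. if e \<in> ?E then g e else 0)"
  have lookup_G: "Poly_Mapping.lookup G e = (if e \<in> ?E then g e else 0)" for e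
    unfolding G_def
    by (subst lookup_Abs_poly_mapping) (auto intro: finite_subset[OF _ finite_exponents[of m]] split: if_splits)
  have "G \<in> S"
    using g(2) by (auto simp: a form_def in_keys_iff lookup_G a'_def less_Suc_eq split: if_splits)
  then obtain c where c: "G = Poly_Mapping.single 0 c * \<Upsilon>" using assms(2) by blast
  have "g e0 = (\<Sum>e\<in>?E. a' q e * g e)"
    using \<open>e0 \<in> ?E\<close> by (simp add: finite_exponents a'_def if_distrib[of "\<lambda>x. x * _"] cong: if_cong)
  with g(2) have "g e0 = 0" by simp
  with c e0 lookup_G[of e0] \<open>e0 \<in> ?E\<close> have "c = 0" by (simp add: lookup_scale)
  with c have "G = 0" by simp
  then have "g e = 0" if "e \<in> ?E" for e
    using lookup_G[of e] that by simp
  with g(1) show False by blast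
qed

section \<open>Planes through camera centers\<close>

definition dot :: "(4 \<Rightarrow> complex) \<Rightarrow> (4 \<Rightarrow> complex) \<Rightarrow> complex" where
  "dot x y = (\<Sum>i\<in>UNIV. x i * y i)"

text \<open>
  A plane through the points \<open>c\<close> and \<open>c'\<close> that depends polynomially on them: up to the factor
  \<open>c q * c' r - c' q * c r\<close>, it is obtained from \<open>h\<close> by changing the coordinates \<open>q\<close> and \<open>r\<close>
  according to Cramer's rule such that both points lie on it.
\<close>
definition pencil_plane ::
  "(4 \<Rightarrow> complex) \<Rightarrow> 4 \<Rightarrow> 4 \<Rightarrow> (4 \<Rightarrow> complex) \<Rightarrow> (4 \<Rightarrow> complex) \<Rightarrow> 4 \<Rightarrow> complex" where
  "pencil_plane h q r c c' i = (c q * c' r - c' q * c r) * h i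
     - (if i = q then dot h c * c' r - dot h c' * c r else 0)
     - (if i = r then c q * dot h c' - c' q * dot h c else 0)"

lemma dot_pencil_plane:
  "dot (pencil_plane h q r c c') x = (c q * c' r - c' q * c r) * dot h x
     - (dot h c * c' r - dot h c' * c r) * x q - (c q * dot h c' - c' q * dot h c) * x r"
  unfolding dot_def[of _ x]
  by (simp add: pencil_plane_def left_diff_distrib sum_subtractf if_distrib[of "\<lambda>t. t * _"]
      sum_distrib_left mult.assoc cong: if_cong)

lemma pencil_plane_contains_centers:
  "dot (pencil_plane h q r c c') c = 0" "dot (pencil_plane h q r c c') c' = 0"
  by (simp_all add: dot_pencil_plane algebra_simps)

lemma pencil_plane_proportional: "pencil_plane h q r (\<lambda>l. s * c l) c = (\<lambda>i. 0)"
proof -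
  have "dot h (\<lambda>l. s * c l) = s * dot h c"
    by (simp add: dot_def sum_distrib_left mult_ac)
  then show ?thesis by (simp add: pencil_plane_def fun_eq_iff)
qed

lemma poly_fun_pencil_plane:
  assumes "\<And>l. poly_fun V (\<lambda>x. c x l)" "\<And>l. poly_fun V (\<lambda>x. c' x l)"
  shows "poly_fun V (\<lambda>x. pencil_plane h q r (c x) (c' x) i)"
  unfolding pencil_plane_def dot_def
  by (intro poly_fun_diff poly_fun_if poly_fun_mult poly_fun_sum poly_fun_const assms)

text \<open>
  Two points of the plane \<open>h\<close> with coordinates \<open>(1, 0)\<close> and \<open>(0, 1)\<close> at the places \<open>q\<close> and \<open>r\<close>
  need no correction, and the determinant is 1 for them.
\<close>
lemma pencil_plane_generic:
  assumes "h p \<noteq> 0" "q \<noteq> p" "r \<noteq> p" "q \<noteq> r"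
  obtains c c' where "pencil_plane h q r c c' = h"
proof -
  define e where "e a = (\<lambda>i. if i = a then 1 else if i = p then - h a / h p else 0)" for a
  have dot: "dot h (e a) = 0" if "a \<noteq> p" for a
  proof -
    have "dot h (e a) = h a * e a a + (h p * e a p + (\<Sum>i\<in>UNIV - {a} - {p}. h i * e a i))"
      using that by (simp add: dot_def sum.remove[of UNIV a] sum.remove[of "UNIV - {a}" p])
    also have "(\<Sum>i\<in>UNIV - {a} - {p}. h i * e a i) = 0"
      by (rule sum.neutral) (auto simp: e_def)
    finally show ?thesis using that assms(1) by (simp add: e_def)
  qed
  have "pencil_plane h q r (e q) (e r) = h"
    using dot[OF assms(2)] dot[OF assms(3)] assms(2-4) by (simp add: pencil_plane_def fun_eq_iff) (simp add: e_def)
  with that show thesis by blast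
qed

text \<open>
  The plane \<open>h\<close> is chosen off the zeros of \<open>\<Upsilon>\<close>, and the coordinates \<open>q\<close> and \<open>r\<close> differ from one in
  which \<open>h\<close> is nonzero.
\<close>
lemma generic_pencil_condition:
  fixes \<Upsilon> :: "4 cpoly"
  assumes "form m \<Upsilon>" "m > 0" "\<Upsilon> \<noteq> 0"
  obtains h q r where "\<exists>c c'. peval \<Upsilon> (pencil_plane h q r c c') \<noteq> 0"
proof -
  obtain h where h: "peval \<Upsilon> h \<noteq> 0" by (rule nonzero_value[OF assms(3)])
  have "h \<noteq> (\<lambda>i. 0)" using peval_zero_vector[OF assms(1,2)] h by auto
  then obtain p where p: "h p \<noteq> 0" by auto
  have "card (UNIV - {p}) = 3" by (simp add: card_Diff_singleton)
  then obtain q where q: "q \<noteq> p" by (metis DiffD2 all_not_in_conv card.empty singletonI zero_neq_numeral)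
  have "card (UNIV - {p, q}) = 2" using q by (simp add: card_Diff_subset)
  then have "UNIV - {p, q} \<noteq> {}" by force
  then obtain r where r: "r \<noteq> p" "q \<noteq> r" by auto
  obtain c c' where "pencil_plane h q r c c' = h"
    using pencil_plane_generic[of h p q r] p q r by blast
  with h have "peval \<Upsilon> (pencil_plane h q r c c') \<noteq> 0" by simp
  with that show thesis by blast
qed

text \<open>
  A generic line through a point outside the zeros of \<open>H\<close> would meet the \<open>m + 1\<close> hyperplanes in
  distinct points, which are \<open>m + 1\<close> roots of the restriction of \<open>H\<close> to that line.
\<close>
lemma form_vanishing_on_hyperplanes:
  fixes H :: "('v::finite) cpoly" and c :: "nat \<Rightarrow> 'v \<Rightarrow> complex"
  assumes "form m H"
    and vanish: "\<And>i x. i \<le> m \<Longrightarrow> (\<Sum>l\<in>UNIV. c i l * x l) = 0 \<Longrightarrow> peval H x = 0"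
    and indep: "\<And>i j s. i \<le> m \<Longrightarrow> j \<le> m \<Longrightarrow> i \<noteq> j \<Longrightarrow> c i \<noteq> (\<lambda>l. s * c j l)"
  shows "H = 0"
proof (rule ccontr)
  assume "H \<noteq> 0"
  then obtain z where z: "peval H z \<noteq> 0" by (rule nonzero_value)
  define L where "L i x = (\<Sum>l\<in>UNIV. c i l * x l)" for i and x :: "'v \<Rightarrow> complex"
  have Lz: "L i z \<noteq> 0" if "i \<le> m" for i
    using vanish that z by (auto simp: L_def)
  \<comment> \<open>The line through \<open>z\<close> in direction \<open>y\<close> meets hyperplane \<open>i\<close> if \<open>f (i, i) y\<close> is nonzero, and it meets
     hyperplanes \<open>i\<close> and \<open>j\<close> in distinct points if \<open>f (i, j) y\<close> is nonzero.\<close>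
  define f where "f = (\<lambda>(i, j) y. if i = j then L i y else L i y * L j z - L j y * L i z)"
  have L_unit: "L i (\<lambda>l. if l = l0 then 1 else 0) = c i l0" for i l0
    by (simp add: L_def if_distrib cong: if_cong)
  have poly_L: "poly_fun UNIV (L i)" for i
    unfolding L_def by (intro poly_fun_sum poly_fun_mult poly_fun_const poly_fun_var) auto
  have "\<exists>F. F \<noteq> 0 \<and> (\<forall>e\<in>Poly_Mapping.keys F. Poly_Mapping.keys e \<subseteq> UNIV) \<and>
    (\<forall>x. peval F x \<noteq> 0 \<longrightarrow> (\<forall>a\<in>{..m} \<times> {..m}. f a x \<noteq> 0))"
  proof (rule poly_fun_family_generic)
    fix a assume "a \<in> {..m} \<times> {..m}"
    then obtain i j where ij: "a = (i, j)" "i \<le> m" "j \<le> m" by auto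
    show "poly_fun UNIV (f a)"
      unfolding ij f_def prod.case
      by (cases "i = j") (simp_all add: poly_L poly_fun_diff poly_fun_mult poly_fun_const)
    show "\<exists>x. f a x \<noteq> 0"
    proof (cases "i = j")
      case True
      with ij Lz show ?thesis by (intro exI[of _ z]) (simp add: f_def)
    next
      case False
      from indep[OF ij(2,3) False, of "L i z / L j z"] obtain l0 where "c i l0 \<noteq> L i z / L j z * c j l0"
        by auto
      with ij Lz[of j] have "c i l0 * L j z - c j l0 * L i z \<noteq> 0"
        by (simp add: field_simps)
      with ij False show ?thesis
        by (intro exI[of _ "\<lambda>l. if l = l0 then 1 else 0"]) (simp add: f_def L_unit)
    qed
  qed simp
  then obtain F where "F \<noteq> 0" and F: "\<forall>x. peval F x \<noteq> 0 \<longrightarrow> (\<forall>a\<in>{..m} \<times> {..m}. f a x \<noteq> 0)"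
    by blast
  obtain y where "peval F y \<noteq> 0" by (rule nonzero_value[OF \<open>F \<noteq> 0\<close>])
  with F have y: "f (i, j) y \<noteq> 0" if "i \<le> m" "j \<le> m" for i j
    using that by auto
  obtain P where P: "\<forall>t. poly P t = peval H (\<lambda>i. z i + t * y i)" "degree P \<le> m"
    using peval_on_line[of H z y] assms(1) by blast
  have "P \<noteq> 0" using P(1)[rule_format, of 0] z by auto
  define t where "t i = - L i z / L i y" for i
  have Ly: "L i y \<noteq> 0" if "i \<le> m" for i
    using y[of i i] that by (simp add: f_def)
  have root: "poly P (t i) = 0" if "i \<le> m" for i
  proof -
    have "L i (\<lambda>l. z l + t i * y l) = L i z + t i * L i y"
      by (simp add: L_def algebra_simps sum.distrib sum_distrib_left)
    also have "\<dots> = 0" using Ly[OF that] by (simp add: t_def)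
    finally show ?thesis using vanish[OF that] P(1) by (simp add: L_def)
  qed
  have "inj_on t {..m}"
  proof (rule inj_onI)
    fix i j assume ij: "i \<in> {..m}" "j \<in> {..m}" "t i = t j"
    then have "L i y * L j z - L j y * L i z = 0"
      using Ly[of i] Ly[of j] by (simp add: t_def field_simps)
    with y[of i j] ij show "i = j" by (auto simp: f_def split: if_splits)
  qed
  then have "card (t ` {..m}) = Suc m" by (simp add: card_image)
  moreover have "card (t ` {..m}) \<le> card {s. poly P s = 0}"
    using root by (intro card_mono poly_roots_finite \<open>P \<noteq> 0\<close>) auto
  moreover have "card {s. poly P s = 0} \<le> degree P"
    by (rule card_poly_roots_bound[OF \<open>P \<noteq> 0\<close>])
  ultimately show False using P(2) by simp
qed

section \<open>Reconstruction from generic centers\<close>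

lemma pairing_dot: "pairing h x = dot (($) h) (($) x)"
  by (simp add: pairing_def dot_def)

lemma peval_on_plane_through_center:
  assumes "camera_center M c" "dot x (($) c) = 0"
  obtains l where "x = ($) (\<mu> M l)"
proof -
  have x: "x = ($) (\<chi> i. x i)" by (simp add: fun_eq_iff)
  have "pairing (\<chi> i. x i) c = 0" using assms(2) by (simp add: pairing_dot flip: x)
  then obtain l where "(\<chi> i. x i) = \<mu> M l" by (rule plane_through_center[OF assms(1)])
  with x that show thesis by metis
qed

text \<open>
  The assumption \<open>pencils\<close> has two uses. It exhibits a plane through two centers at which \<open>\<Upsilon>\<close> is
  nonzero, so the ratios of \<open>G\<close> to \<open>\<Upsilon>\<close> on the planes through these two centers agree. It also implies
  that any two centers are distinct points, since the Cramer plane of proportional vectors is zero.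
\<close>
lemma reconstruction_from_generic_centers:
  fixes \<Upsilon> :: "4 cpoly"
  assumes \<Upsilon>: "form m \<Upsilon>" "m > 0" and k: "k > m"
    and centers: "\<And>i. i < k \<Longrightarrow> camera_center (M i) (c i)"
    and views: "\<And>i. i < k \<Longrightarrow> \<exists>s. \<forall>l. peval \<Upsilon> (($) (\<mu> (M i) l)) = s * peval (\<phi> i) (($) l)"
    and pencils: "\<And>i j. i < k \<Longrightarrow> j < k \<Longrightarrow> i \<noteq> j \<Longrightarrow>
      peval \<Upsilon> (pencil_plane h q r (($) (c i)) (($) (c j))) \<noteq> 0"
  shows "linearly_reconstructs m k M \<phi> \<Upsilon>"
  unfolding linearly_reconstructs_def
proof (intro equalityI subsetI)
  fix G assume "G \<in> range (\<lambda>a. Poly_Mapping.single 0 a * \<Upsilon>)"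
  then obtain a where G: "G = Poly_Mapping.single 0 a * \<Upsilon>" by blast
  have "\<exists>s. \<forall>l. peval G (($) (\<mu> (M i) l)) = s * peval (\<phi> i) (($) l)" if i: "i < k" for i
  proof -
    obtain s where "\<forall>l. peval \<Upsilon> (($) (\<mu> (M i) l)) = s * peval (\<phi> i) (($) l)" using views[OF i] by blast
    then show ?thesis by (intro exI[of _ "a * s"]) (simp add: G peval_scale)
  qed
  then show "G \<in> dual_solutions m k M \<phi>"
    using form_scale[OF \<Upsilon>(1)] by (simp add: dual_solutions_def G)
next
  fix G assume "G \<in> dual_solutions m k M \<phi>"
  then have G: "form m G" "\<And>i. i < k \<Longrightarrow> \<exists>s. \<forall>l. peval G (($) (\<mu> (M i) l)) = s * peval (\<phi> i) (($) l)"
    by (auto simp: dual_solutions_def)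
  let ?P = "\<lambda>i j. pencil_plane h q r (($) (c i)) (($) (c j))"
  have ratio: "\<exists>a. \<forall>x. dot x (($) (c i)) = 0 \<longrightarrow> peval G x = a * peval \<Upsilon> x" if i: "i < k" for i
  proof -
    obtain s where s: "\<forall>l. peval G (($) (\<mu> (M i) l)) = s * peval (\<phi> i) (($) l)" using G(2)[OF i] by blast
    obtain t where t: "\<forall>l. peval \<Upsilon> (($) (\<mu> (M i) l)) = t * peval (\<phi> i) (($) l)" using views[OF i] by blast
    \<comment> \<open>Any second view will do; it exists since \<open>k > m > 0\<close>.\<close>
    define j where "j = (if i = 0 then 1 else 0 :: nat)"
    have "j < k" "i \<noteq> j" using k \<Upsilon>(2) i by (auto simp: j_def)
    with pencils i have "peval \<Upsilon> (?P i j) \<noteq> 0" by blast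
    moreover obtain l where "?P i j = ($) (\<mu> (M i) l)"
      by (rule peval_on_plane_through_center[OF centers[OF i] pencil_plane_contains_centers(1)])
    ultimately have "t \<noteq> 0" using t by auto
    have "peval G x = s / t * peval \<Upsilon> x" if x: "dot x (($) (c i)) = 0" for x
    proof -
      obtain l where "x = ($) (\<mu> (M i) l)"
        by (rule peval_on_plane_through_center[OF centers[OF i] x])
      with s t \<open>t \<noteq> 0\<close> show ?thesis by simp
    qed
    then show ?thesis by blast
  qed
  obtain a where a: "\<forall>x. dot x (($) (c 0)) = 0 \<longrightarrow> peval G x = a * peval \<Upsilon> x"
    using ratio[of 0] k by auto
  have same_ratio: "peval G x = a * peval \<Upsilon> x" if i: "i < k" and x: "dot x (($) (c i)) = 0" for i x
  proof (cases "i = 0")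
    case False
    obtain b where b: "\<forall>x. dot x (($) (c i)) = 0 \<longrightarrow> peval G x = b * peval \<Upsilon> x"
      using ratio[OF i] by blast
    have "b * peval \<Upsilon> (?P 0 i) = a * peval \<Upsilon> (?P 0 i)"
      using a b pencil_plane_contains_centers[of h q r "($) (c 0)" "($) (c i)"] by metis
    moreover have "peval \<Upsilon> (?P 0 i) \<noteq> 0" using pencils[of 0 i] i False by simp
    ultimately have "b = a" by simp
    with b x show ?thesis by blast
  qed (use a x in blast)
  have "G - Poly_Mapping.single 0 a * \<Upsilon> = 0"
  proof (rule form_vanishing_on_hyperplanes)
    show "form m (G - Poly_Mapping.single 0 a * \<Upsilon>)"
      by (intro form_diff form_scale G(1) \<Upsilon>(1))
    fix i assume i: "i \<le> m"
    show "peval (G - Poly_Mapping.single 0 a * \<Upsilon>) x = 0" if "(\<Sum>l\<in>UNIV. c i $ l * x l) = 0" for x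
    proof -
      have "dot x (($) (c i)) = 0" using that by (simp add: dot_def mult.commute)
      with same_ratio[of i x] i k show ?thesis by (simp add: peval_diff peval_scale)
    qed
    fix j s assume j: "j \<le> m" "i \<noteq> j"
    show "($) (c i) \<noteq> (\<lambda>l. s * c j $ l)"
    proof
      assume "($) (c i) = (\<lambda>l. s * c j $ l)"
      then have "?P i j = (\<lambda>i. 0)" using pencil_plane_proportional[of h q r s "($) (c j)"] by simp
      with pencils[of i j] i j k peval_zero_vector[OF \<Upsilon>] show False by simp
    qed
  qed
  then show "G \<in> range (\<lambda>a. Poly_Mapping.single 0 a * \<Upsilon>)" by auto
qed

text \<open>
  The generic conditions on the centers are indexed by pairs of views: the diagonal pairs make each
  view a dual view, the other ones are the conditions on the lines of planes through two centers.
\<close>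
lemma generic_reconstruction:
  fixes \<Upsilon> :: "4 cpoly"
  assumes X: "\<And>x. x \<in> X \<Longrightarrow> smooth_point X x" and dual: "dual_variety X \<subseteq> zero_locus {\<Upsilon>}"
    and \<Upsilon>: "form m \<Upsilon>" "m > 0" "\<Upsilon> \<noteq> 0" and degree: "generic_dual_degree X m" and k: "k > m"
  shows "for_generic_centers k (\<lambda>M. \<exists>\<phi>.
           (\<forall>i<k. dual_view m X (M i) (\<phi> i)) \<and> linearly_reconstructs m k M \<phi> \<Upsilon>)"
proof -
  obtain F1 :: "(nat \<times> 4) cpoly" where F1: "F1 \<noteq> 0" "\<forall>e\<in>Poly_Mapping.keys F1. Poly_Mapping.keys e \<subseteq> {..<1} \<times> UNIV"
    "\<forall>M c. (\<forall>i<1. camera_center (M i) (c i)) \<and> peval F1 (\<lambda>(i, j). c i $ j) \<noteq> 0 \<longrightarrow> (\<exists>\<phi>. dual_view m X (M 0) \<phi>)"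
    using degree unfolding generic_dual_degree_def for_generic_centers_def by blast
  obtain h q r where hqr: "\<exists>c c'. peval \<Upsilon> (pencil_plane h q r c c') \<noteq> 0"
    by (rule generic_pencil_condition[OF \<Upsilon>])
  \<comment> \<open>The polynomial \<open>F1\<close> uses only the variables of center 0; they are replaced by those of center \<open>i\<close>.\<close>
  define f where "f = (\<lambda>(i, j) (x :: nat \<times> 4 \<Rightarrow> complex). if i = j then peval F1 (\<lambda>(n, l). x (i, l))
    else peval \<Upsilon> (pencil_plane h q r (\<lambda>l. x (i, l)) (\<lambda>l. x (j, l))))"
  have "\<exists>F. F \<noteq> 0 \<and> (\<forall>e\<in>Poly_Mapping.keys F. Poly_Mapping.keys e \<subseteq> {..<k} \<times> UNIV) \<and>
    (\<forall>x. peval F x \<noteq> 0 \<longrightarrow> (\<forall>a\<in>{..<k} \<times> {..<k}. f a x \<noteq> 0))"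
  proof (rule poly_fun_family_generic)
    fix a assume "a \<in> {..<k} \<times> {..<k}"
    then obtain i j where a: "a = (i, j)" "i < k" "j < k" by auto
    show "poly_fun ({..<k} \<times> UNIV) (f a)"
    proof (cases "i = j")
      case True
      have "poly_fun ({..<k} \<times> UNIV) (\<lambda>x. peval F1 (\<lambda>nl. x (i, snd nl)))"
        using a(2) by (intro poly_fun_compose poly_fun_var) auto
      with True show ?thesis by (simp add: a f_def case_prod_unfold)
    next
      case False
      have "poly_fun ({..<k} \<times> UNIV)
          (\<lambda>x. peval \<Upsilon> (\<lambda>t. pencil_plane h q r (\<lambda>l. x (i, l)) (\<lambda>l. x (j, l)) t))"
        using a(2,3) by (intro poly_fun_compose poly_fun_pencil_plane poly_fun_var) auto
      with False show ?thesis by (simp add: a f_def)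
    qed
    show "\<exists>x. f a x \<noteq> 0"
    proof (cases "i = j")
      case True
      obtain x where x: "peval F1 x \<noteq> 0" by (rule nonzero_value[OF F1(1)])
      have "peval F1 (\<lambda>(n, l). x (0, l)) = peval F1 x"
        unfolding peval_def using F1(2)
        by (intro sum.cong prod.cong refl arg_cong2[of _ _ _ _ "(*)"]) (fastforce simp: lessThan_def)
      with x True show ?thesis
        by (intro exI[of _ "\<lambda>(n, l). x (0, l)"]) (simp add: a f_def)
    next
      case False
      obtain c c' where "peval \<Upsilon> (pencil_plane h q r c c') \<noteq> 0" using hqr by blast
      with False show ?thesis
        by (intro exI[of _ "\<lambda>(n, l). if n = i then c l else c' l"]) (simp add: a f_def)
    qed
  qed simp
  then obtain F where F: "F \<noteq> 0" "\<forall>e\<in>Poly_Mapping.keys F. Poly_Mapping.keys e \<subseteq> {..<k} \<times> UNIV"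
    "\<forall>x. peval F x \<noteq> 0 \<longrightarrow> (\<forall>a\<in>{..<k} \<times> {..<k}. f a x \<noteq> 0)" by blast
  have "\<exists>\<phi>. (\<forall>i<k. dual_view m X (M i) (\<phi> i)) \<and> linearly_reconstructs m k M \<phi> \<Upsilon>"
    if M: "\<forall>i<k. camera_center (M i) (c i)" and c: "peval F (\<lambda>(i, j). c i $ j) \<noteq> 0" for M c
  proof -
    have f: "f (i, j) (\<lambda>(i, j). c i $ j) \<noteq> 0" if "i < k" "j < k" for i j
      using F(3) c that by blast
    have "\<exists>p. dual_view m X (M i) p" if i: "i < k" for i
    proof -
      have "(\<forall>n<1. camera_center (M i) (c i)) \<and> peval F1 (\<lambda>(n, l). c i $ l) \<noteq> 0"
        using M f[OF i i] i by (simp add: f_def)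
      then show ?thesis using F1(3)[THEN spec, of "\<lambda>_. M i", THEN spec, of "\<lambda>_. c i"] by blast
    qed
    then have "\<forall>i\<in>{..<k}. \<exists>p. dual_view m X (M i) p" by simp
    from bchoice[OF this] obtain \<phi> where \<phi>: "\<And>i. i < k \<Longrightarrow> dual_view m X (M i) (\<phi> i)" by auto
    have "linearly_reconstructs m k M \<phi> \<Upsilon>"
    proof (rule reconstruction_from_generic_centers[OF \<Upsilon>(1,2) k])
      show "camera_center (M i) (c i)" if "i < k" for i using M that by blast
      show "\<exists>s. \<forall>l. peval \<Upsilon> (($) (\<mu> (M i) l)) = s * peval (\<phi> i) (($) l)" if "i < k" for i
        by (rule dual_view_equation[OF X dual \<Upsilon>(1,2) \<phi>[OF that]])
      show "peval \<Upsilon> (pencil_plane h q r (($) (c i)) (($) (c j))) \<noteq> 0" if "i < k" "j < k" "i \<noteq> j" for i j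
        using f[OF that(1,2)] that(3) by (simp add: f_def)
    qed
    with \<phi> show ?thesis by blast
  qed
  with F(1,2) show ?thesis
    unfolding for_generic_centers_def by blast
qed

theorem proposition8:
  fixes X :: "(complex^4) set" and d m :: nat and \<Upsilon> :: "4 cpoly"
  assumes "smooth_irreducible_curve X"
    and "curve_degree X d" and "d \<ge> 2"
    and "generic_dual_degree X m"
    and "minimal_equation m (dual_variety X) \<Upsilon>"
  shows
    "(\<forall>k M \<phi>. (\<forall>i<k. dual_view m X (M i) (\<phi> i)) \<longrightarrow>
        \<Upsilon> \<in> dual_solutions m k M \<phi> \<and>
        linear_system m (k * ((m + 2 choose m) - 1)) (dual_solutions m k M \<phi>) \<and>
        (linearly_reconstructs m k M \<phi> \<Upsilon> \<longrightarrow>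
           real k \<ge> (real m ^ 2 + 6 * real m + 11) / (3 * (real m + 3))))
     \<and> card (exponents m :: (4 \<Rightarrow>\<^sub>0 nat) set) = (m + 3 choose m)
     \<and> (\<forall>k. k * ((m + 2 choose m) - 1) \<ge> (m + 3 choose m) - 1 \<longleftrightarrow>
           real k \<ge> (real m ^ 2 + 6 * real m + 11) / (3 * (real m + 3)))
     \<and> (\<exists>k\<^sub>0. \<forall>k\<ge>k\<^sub>0. for_generic_centers k (\<lambda>M. \<exists>\<phi>.
           (\<forall>i<k. dual_view m X (M i) (\<phi> i)) \<and> linearly_reconstructs m k M \<phi> \<Upsilon>))"
proof (intro conjI allI impI)
  have X: "\<And>x. x \<in> X \<Longrightarrow> smooth_point X x"
    using assms(1) by (simp add: smooth_irreducible_curve_def)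
  have \<Upsilon>: "\<Upsilon> \<noteq> 0" "form m \<Upsilon>" and dual: "dual_variety X \<subseteq> zero_locus {\<Upsilon>}"
    using assms(5) by (auto simp: minimal_equation_def)
  have m: "m > 0" by (rule dual_degree_positive[OF assms(1) \<Upsilon>(2,1) dual])
  have card: "card (exponents m :: (4 \<Rightarrow>\<^sub>0 nat) set) = (m + 3 choose m)"
  proof -
    have "m + CARD(4) - 1 = m + 3" by simp
    then show ?thesis using card_exponents[where 'v = 4, of m] by (simp only:)
  qed
  show "card (exponents m :: (4 \<Rightarrow>\<^sub>0 nat) set) = (m + 3 choose m)" by (rule card)
  show count: "k * ((m + 2 choose m) - 1) \<ge> (m + 3 choose m) - 1 \<longleftrightarrow>
      real k \<ge> (real m ^ 2 + 6 * real m + 11) / (3 * (real m + 3))" for k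
    by (rule view_count_iff[OF m])
  show "\<exists>k\<^sub>0. \<forall>k\<ge>k\<^sub>0. for_generic_centers k (\<lambda>M. \<exists>\<phi>.
      (\<forall>i<k. dual_view m X (M i) (\<phi> i)) \<and> linearly_reconstructs m k M \<phi> \<Upsilon>)"
    using generic_reconstruction[OF X dual \<Upsilon>(2) m \<Upsilon>(1) assms(4)]
    by (intro exI[of _ "Suc m"]) (simp add: Suc_le_eq)
  fix k :: nat and M \<phi> assume views: "\<forall>i<k. dual_view m X (M i) (\<phi> i)"
  show "\<Upsilon> \<in> dual_solutions m k M \<phi>"
    using dual_view_equation[OF X dual \<Upsilon>(2) m] views \<Upsilon>(2) by (simp add: dual_solutions_def)
  have view_system: "linear_system m ((m + 2 choose m) - 1)
      {G. form m G \<and> (\<exists>s. \<forall>l. peval G (($) (\<mu> (M i) l)) = s * peval (\<phi> i) (($) l))}" if "i < k" for i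
  proof (rule view_equations_linear)
    show "\<phi> i \<noteq> 0" "form m (\<phi> i)" using views that by (auto simp: dual_view_def)
  qed
  have "dual_solutions m k M \<phi> = {G. form m G \<and> (\<forall>i<k. G \<in>
      {G. form m G \<and> (\<exists>s. \<forall>l. peval G (($) (\<mu> (M i) l)) = s * peval (\<phi> i) (($) l))})}"
    by (auto simp: dual_solutions_def)
  then show system: "linear_system m (k * ((m + 2 choose m) - 1)) (dual_solutions m k M \<phi>)"
    by (simp only:) (rule linear_system_intersection[OF view_system])
  assume "linearly_reconstructs m k M \<phi> \<Upsilon>"
  then have "k * ((m + 2 choose m) - 1) \<ge> (m + 3 choose m) - 1"
    using unique_solution_needs_equations[OF system _ \<Upsilon>(1)] card
    by (simp add: linearly_reconstructs_def)
  then show "real k \<ge> (real m ^ 2 + 6 * real m + 11) / (3 * (real m + 3))"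
    using count by blast
qed

end
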